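(* Let $n\ge 1$, let $\lambda_1,\dots,\lambda_n\in\mathbb R$, let $H_{n+1}=\mathbb C^n\times\mathbb R$ carry the CR structure determined by $\lambda_1,\dots,\lambda_n$, and let $q\in\{0,1,\dots,n\}$. (i) If $\lambda_j=0$ for some $j$, then $\mathcal H^q_b(H_{n+1})=\{0\}$. (ii) Suppose that all $\lambda_j$ are non-zero, let $n_-$ be the number of negative $\lambda_j$'s and $n_+$ the number of positive $\lambda_j$'s. If $q\notin\{n_-,n_+\}$, then $\mathcal H^q_b(H_{n+1})=\{0\}$.
   Context: Coordinates on $H_{n+1}=\mathbb C^n\times\mathbb R$ are $x=(z,x_{2n+1})=(x_1,\dots,x_{2n+1})$, with $z=(z_1,\dots,z_n)$, $z_j=x_{2j-1}+ix_{2j}$. For given $\lambda_1,\dots,\lambda_n\in\mathbb R$ the CR structure $T^{1,0}H_{n+1}$ is spanned over $\mathbb C$ by $Z_j=\frac{\partial}{\partial z_j}-i\lambda_j\overline z_j\frac{\partial}{\partial x_{2n+1}}$, $j=1,\dots,n$; $T^{0,1}H_{n+1}$ is its complex conjugate, and $T=-\frac{\partial}{\partial x_{2n+1}}$. Fix a Hermitian metric on $\mathbb CTH_{n+1}$ for which $T$, $T^{1,0}H_{n+1}$, $T^{0,1}H_{n+1}$ are mutually orthogonal and $\langle Z_j|Z_k\rangle=\langle\overline Z_j|\overline Z_k\rangle=\delta_{jk}$. The bundle of $(0,q)$-forms $\Lambda^qT^{*0,1}H_{n+1}$ is spanned by $d\overline z^J=d\overline z_{j_1}\wedge\cdots\wedge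 d\overline z_{j_q}$, $J=(j_1,\dots,j_q)$ strictly increasing, and these are orthonormal for the induced metric. The volume form is $d\mu_{H_{n+1}}=2^n\,dx_1\cdots dx_{2n+1}$. $L^2_{(0,q)}(H_{n+1})$ is the completion of the smooth compactly supported $(0,q)$-forms $\Omega^{0,q}_0(H_{n+1})$ with respect to $(u|v)=\int\langle u|v\rangle\,d\mu_{H_{n+1}}$. The tangential Cauchy-Riemann operator is $\overline\partial_b u=\sum'_{J}\sum_{j=1}^n(\overline Z_ju_J)\,d\overline z_j\wedge d\overline z^J$ for $u=\sum'_Ju_Jd\overline z^J$ (sum over strictly increasing $J$), $\overline Z_j=\frac{\partial}{\partial\overline z_j}+i\lambda_jz_j\frac{\partial}{\partial x_{2n+1}}$. It is extended to $L^2$ with domain $\{u\in L^2_{(0,r)}:\overline\partial_bu\in L^2_{(0,r+1)}\}$ ($\overline\partial_b u$ in the sense of distributions), and $\overline\partial_b^*$ is its Hilbert space adjoint. The Kohn Laplacian is $\Box^{(q)}_b=\overline\partial_b\overline\partial_b^*+\overline\partial_b^*\overline\partial_b$ with domain $\{s\in L^2_{(0,q)}: s\in\mathrm{Dom}\,\overline\partial_b\cap\mathrm{Dom}\,\overline\partial_b^*,\ \overline\partial_bs\in\mathrm{Dom}\,\overline\partial_b^*,\ \overline\partial_b^*s\in\mathrm{Dom}\,\overline\partial_b\}$. Finally $\mathcal H^q_b(H_{n+1}):=\mathrm{Ker}\,\Box^{(q)}_b\subset L^2_{(0,q)}(H_{n+1})$. *)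

theory Defs
  imports "HOL-Analysis.Analysis"
begin

text \<open>
  A point of the Heisenberg group is \<open>(z, t)\<close> with \<open>z = (z\<^sub>1, \<dots>, z\<^sub>n)\<close> and \<open>t = x\<^sub>2\<^sub>n\<^sub>+\<^sub>1\<close>. The
  index type \<open>'n\<close> plays the role of \<open>{1, \<dots>, n}\<close>; its linear order is only needed to speak of
  strictly increasing multi-indices. The coordinate vector fields of \<open>x\<^sub>2\<^sub>j\<^sub>-\<^sub>1\<close>, \<open>x\<^sub>2\<^sub>j\<close> and
  \<open>x\<^sub>2\<^sub>n\<^sub>+\<^sub>1\<close> are \<open>(axis j 1, 0)\<close>, \<open>(axis j \<i>, 0)\<close> and \<open>(0, 1)\<close>.
\<close>

type_synonym 'n heis = "(complex ^ 'n) \<times> real"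

definition heis_volume :: "('n::finite) heis measure" where
  "heis_volume = density lborel (\<lambda>_. ennreal (2 ^ CARD('n)))"


subsection \<open>Test functions and distributions\<close>

text \<open>\<open>Ck k f\<close>: the function \<open>f\<close> is of class \<open>C\<^sup>k\<close> (on a finite-dimensional space).\<close>

primrec Ck :: "nat \<Rightarrow> ('a::real_normed_vector \<Rightarrow> 'b::real_normed_vector) \<Rightarrow> bool" where
  "Ck 0 f \<longleftrightarrow> continuous_on UNIV f"
| "Ck (Suc k) f \<longleftrightarrow> (\<forall>x. f differentiable (at x)) \<and>
     (\<forall>v. Ck k (\<lambda>x. frechet_derivative f (at x) v))"

definition test_functions :: "(('n::finite) heis \<Rightarrow> complex) set" where
  "test_functions = {\<phi>. (\<forall>k. Ck k \<phi>) \<and> compact (closure {x. \<phi> x \<noteq> 0})}"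

text \<open>
  Distributions are represented by functionals of which only the values on \<^const>\<open>test_functions\<close>
  matter.
\<close>

type_synonym 'n dist = "('n heis \<Rightarrow> complex) \<Rightarrow> complex"

definition dist_of :: "(('n::finite) heis \<Rightarrow> complex) \<Rightarrow> 'n dist" where
  "dist_of f = (\<lambda>\<phi>. LINT x|heis_volume. f x * \<phi> x)"

definition dist_deriv :: "('n::finite) heis \<Rightarrow> 'n dist \<Rightarrow> 'n dist" where
  "dist_deriv v D = (\<lambda>\<phi>. - D (\<lambda>x. frechet_derivative \<phi> (at x) v))"

definition dist_mult :: "(('n::finite) heis \<Rightarrow> complex) \<Rightarrow> 'n dist \<Rightarrow> 'n dist" where
  "dist_mult a D = (\<lambda>\<phi>. D (\<lambda>x. a x * \<phi> x))"

definition Zbar :: "('n::finite \<Rightarrow> real) \<Rightarrow> 'n \<Rightarrow> 'n dist \<Rightarrow> 'n dist" where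
  "Zbar l j D = (\<lambda>\<phi>.
     (dist_deriv (axis j 1, 0) D \<phi> + \<i> * dist_deriv (axis j \<i>, 0) D \<phi>) / 2
     + dist_mult (\<lambda>(z, t). \<i> * of_real (l j) * z $ j) (dist_deriv (0, 1) D) \<phi>)"


subsection \<open>Forms of type (0,q)\<close>

text \<open>
  A strictly increasing multi-index \<open>J\<close> is the same thing as a set of indices. An element \<open>w\<close> of
  the exterior algebra spanned by the \<open>dzbar\<^sup>J\<close> is given by its coefficients \<open>w $ J\<close>; the vector
  \<open>dzbar\<^sup>J\<close> is \<open>axis J 1\<close>. These are orthonormal for the chosen metric, so that the induced
  pointwise norm is the library norm of \<open>complex ^ 'n set\<close>.
\<close>

type_synonym 'n form = "'n heis \<Rightarrow> complex ^ 'n set"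

text \<open>\<open>dzbar\<^sub>j \<and> dzbar\<^sup>J\<close>: the sign comes from sorting \<open>j\<close> into \<open>J\<close>.\<close>

definition dzbar_wedge :: "'n::{finite,linorder} \<Rightarrow> 'n set \<Rightarrow> complex ^ 'n set" where
  "dzbar_wedge j J = (if j \<in> J then 0 else axis (insert j J) ((-1) ^ card {k \<in> J. k < j}))"

text \<open>
  Square integrable \<open>(0,r)\<close>-forms. Representatives are not identified here; two of them give the
  same element of the Hilbert space iff they agree almost everywhere. The degree is an integer,
  so that the spaces of \<open>(0,-1)\<close>-forms and of \<open>(0,n+1)\<close>-forms are trivial.
\<close>

definition L2 :: "int \<Rightarrow> ('n::finite) form set" where
  "L2 r = {u \<in> borel_measurable heis_volume.
     integrable heis_volume (\<lambda>x. (norm (u x))\<^sup>2) \<and>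
     (\<forall>x J. int (card J) \<noteq> r \<longrightarrow> u x $ J = 0)}"

definition L2_inner :: "('n::finite) form \<Rightarrow> 'n form \<Rightarrow> complex" where
  "L2_inner u v = (LINT x|heis_volume. (\<Sum>J\<in>UNIV. u x $ J * cnj (v x $ J)))"

definition L2_null :: "int \<Rightarrow> ('n::finite) form set" where
  "L2_null r = {u \<in> L2 r. AE x in heis_volume. u x = 0}"


subsection \<open>The operators\<close>

text \<open>The coefficient of \<open>dzbar\<^sup>K\<close> in \<open>\<Sum>\<^sub>J \<Sum>\<^sub>j (Zbar\<^sub>j u\<^sub>J) dzbar\<^sub>j \<and> dzbar\<^sup>J\<close>, as a distribution.\<close>

definition dbar_dist ::
  "('n::{finite,linorder} \<Rightarrow> real) \<Rightarrow> 'n form \<Rightarrow> 'n set \<Rightarrow> 'n dist" where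
  "dbar_dist l u K = (\<lambda>\<phi>. \<Sum>J\<in>UNIV. \<Sum>j\<in>UNIV.
     Zbar l j (dist_of (\<lambda>x. u x $ J)) \<phi> * dzbar_wedge j J $ K)"

text \<open>
  Unbounded operators are represented by their graphs, which are closed under changing
  representatives on null sets; the domain of an operator is the \<^const>\<open>Domain\<close> of its graph.
\<close>

definition dbar :: "('n::{finite,linorder} \<Rightarrow> real) \<Rightarrow> int \<Rightarrow> ('n form \<times> 'n form) set" where
  "dbar l r = {(u, f). u \<in> L2 r \<and> f \<in> L2 (r + 1) \<and>
     (\<forall>K. \<forall>\<phi>\<in>test_functions. dbar_dist l u K \<phi> = dist_of (\<lambda>x. f x $ K) \<phi>)}"

text \<open>The Hilbert space adjoint of \<open>dbar l r\<close>, going from \<open>(0,r+1)\<close>-forms to \<open>(0,r)\<close>-forms.\<close>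

definition dbar_adj :: "('n::{finite,linorder} \<Rightarrow> real) \<Rightarrow> int \<Rightarrow> ('n form \<times> 'n form) set" where
  "dbar_adj l r = {(v, w). v \<in> L2 (r + 1) \<and> w \<in> L2 r \<and>
     (\<forall>(u, f)\<in>dbar l r. L2_inner f v = L2_inner u w)}"

text \<open>
  In the following definition \<open>a\<close> and \<open>b\<close> are the images of \<open>s\<close> under the adjoint and under
  \<open>dbar\<close>; both are unique up to null sets, since \<open>dbar\<close> is densely defined.
\<close>

definition kohn_laplacian ::
  "('n::{finite,linorder} \<Rightarrow> real) \<Rightarrow> int \<Rightarrow> ('n form \<times> 'n form) set" where
  "kohn_laplacian l q = {(s, \<lambda>x. f x + g x) | s a f b g.
     (s, a) \<in> dbar_adj l (q - 1) \<and> (a, f) \<in> dbar l (q - 1) \<and>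
     (s, b) \<in> dbar l q \<and> (b, g) \<in> dbar_adj l q}"

definition harmonic_forms :: "('n::{finite,linorder} \<Rightarrow> real) \<Rightarrow> int \<Rightarrow> 'n form set" where
  "harmonic_forms l q = {s. (s, \<lambda>x. 0) \<in> kohn_laplacian l q}"

end

theory Submission
  imports Defs
begin

text \<open>
  If \<open>s\<close> is harmonic, pairing \<open>box\<^sub>b s = 0\<close> with \<open>s\<close> shows that \<open>s\<close> is annihilated by \<open>dbar\<close>
  and by its adjoint. These equations are invariant under left translations of the Heisenberg group,
  so averaging \<open>s\<close> over translations with a test function as weight gives smooth square
  integrable solutions \<open>S\<close>, and it suffices to show that all of them vanish. On components,
  \<open>box\<^sub>b S = 0\<close> is diagonal: the component \<open>L\<close> is killed by the sum of \<open>- Zbar\<^sub>j Z\<^sub>j\<close> for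
  \<open>j \<in> L\<close> and \<open>- Z\<^sub>j Zbar\<^sub>j\<close> for \<open>j \<notin> L\<close>. Since \<open>[Z\<^sub>j, Zbar\<^sub>j] = 2 i \<lambda>\<^sub>j \<partial>\<^sub>t\<close>, swapping the order in
  a fraction of the \<open>j\<close>-th summand costs a multiple of \<open>\<plusminus> \<lambda>\<^sub>j \<partial>\<^sub>t\<close>. If some \<open>\<lambda>\<^sub>j\<close> vanishes, or if
  both signs occur among the \<open>\<plusminus> \<lambda>\<^sub>j\<close> (which fails only for \<open>L = {j. \<lambda>\<^sub>j < 0}\<close> and
  \<open>L = {j. \<lambda>\<^sub>j > 0}\<close>), these costs can be balanced. The operator is then a sum of squares
  in which \<open>Z\<^sub>j\<close> and \<open>Zbar\<^sub>j\<close> both occur for some \<open>j\<close>, and an energy estimate with cutoffs gives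
  \<open>Z\<^sub>j S = Zbar\<^sub>j S = 0\<close>. Hence \<open>S\<close> is constant along a line through each point, and a square
  integrable function with this property is zero.
\<close>


subsection \<open>Calculus of \<open>C\<^sup>k\<close> functions\<close>

text \<open>The operators are the maximal weak ones, so a harmonic form is a priori only square
  integrable, whereas the energy argument differentiates twice. Averaging over left translations
  bridges this gap, because it commutes with all Z_j and Zbar_j at once. The weight is recovered
  exactly by evaluation at the group identity: there the average of the component s_L with weight
  \<phi> is the integral of \<phi> s_L. Hence S_L(0) = 0 for every \<phi> already forces s_L = 0
  almost everywhere.

  Averaging gives S square integrable, but no such control of Z_j S is at hand, so the energy
  identity cannot be integrated over the whole space. The cutoff version leaves an error of size
  R^-2 times the squared norm of S, which disappears as R grows.

  The degree enters only through card L = q: the two index sets for which balancing fails have n_-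
  and n_+ elements. The final contradiction with square integrability uses one constant direction:
  x_{2j-1} if \<lambda>_j = 0, and otherwise t, which the commutator of Z_j and Zbar_j
  produces.\<close>

lemma Ck_imp_continuous_on:
  assumes "Ck k f" shows "continuous_on UNIV f"
proof (cases k)
  case (Suc m)
  then have "f differentiable_on UNIV" using assms by (simp add: differentiable_on_def)
  then show ?thesis by (rule differentiable_imp_continuous_on)
qed (use assms in simp)

lemma Ck_Suc_imp_Ck: "Ck (Suc k) f \<Longrightarrow> Ck k f"
proof (induction k arbitrary: f)
  case 0
  then show ?case using Ck_imp_continuous_on[OF 0] by simp
next
  case (Suc k)
  then show ?case by (metis Ck.simps(2))
qed

lemma Ck_has_derivative:
  "Ck (Suc k) f \<Longrightarrow> (f has_derivative frechet_derivative f (at x)) (at x)"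
  by (simp add: frechet_derivative_works)

lemma Ck_frechet_derivative: "Ck (Suc k) f \<Longrightarrow> Ck k (\<lambda>x. frechet_derivative f (at x) v)"
  by simp

lemma Ck_SucI:
  assumes "\<And>x. (f has_derivative f' x) (at x)" and "\<And>v. Ck k (\<lambda>x. f' x v)"
  shows "Ck (Suc k) f"
proof -
  have "frechet_derivative f (at x) = f' x" for x
    using assms(1) frechet_derivative_at by metis
  then show ?thesis
    using assms by (auto simp: differentiable_def)
qed

lemma Ck_const [simp]: "Ck k (\<lambda>x. c)"
  by (induction k arbitrary: c) auto

lemma Ck_bounded_linear:
  assumes "bounded_linear f" shows "Ck k f"
proof (cases k)
  case 0
  then show ?thesis using assms by (simp add: linear_continuous_on)
next
  case (Suc n)
  have "Ck (Suc n) f"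
    by (rule Ck_SucI[where f' = "\<lambda>_. f"]) (use assms bounded_linear_imp_has_derivative in auto)
  then show ?thesis using Suc by simp
qed

lemma Ck_add:
  assumes "Ck k f" "Ck k g" shows "Ck k (\<lambda>x. f x + g x)"
  using assms
proof (induction k arbitrary: f g)
  case 0
  then show ?case by (auto intro: continuous_intros)
next
  case (Suc k)
  show ?case
    by (rule Ck_SucI[OF has_derivative_add[OF Ck_has_derivative[OF Suc.prems(1)]
          Ck_has_derivative[OF Suc.prems(2)]]])
      (use Suc in auto)
qed

lemma Ck_sum:
  "(\<And>i. i \<in> I \<Longrightarrow> Ck k (f i)) \<Longrightarrow> Ck k (\<lambda>x. \<Sum>i\<in>I. f i x)"
  by (induction I rule: infinite_finite_induct) (auto intro: Ck_add)

text \<open>One induction serves all the products that occur: multiplication, scaling, the inner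
  product in \<open>gauge\<close> and the form \<open>twist\<close> of the group law.\<close>

lemma (in bounded_bilinear) Ck_bilinear:
  assumes "Ck k f" "Ck k g" shows "Ck k (\<lambda>x. prod (f x) (g x))"
  using assms
proof (induction k arbitrary: f g)
  case 0
  then show ?case by (auto intro: continuous_on)
next
  case (Suc k)
  show ?case
  proof (rule Ck_SucI[OF FDERIV[OF Ck_has_derivative[OF Suc.prems(1)]
          Ck_has_derivative[OF Suc.prems(2)]]])
    fix v
    have *: "Ck k f" "Ck k g" using Suc.prems Ck_Suc_imp_Ck by blast+
    show "Ck k (\<lambda>x. prod (f x) (frechet_derivative g (at x) v) + prod (frechet_derivative f (at x) v) (g x))"
      using Suc.prems * by (intro Ck_add Suc.IH) auto
  qed
qed

lemmas Ck_mult = bounded_bilinear.Ck_bilinear[OF bounded_bilinear_mult]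
lemmas Ck_scaleR = bounded_bilinear.Ck_bilinear[OF bounded_bilinear_scaleR]

lemma Ck_linear_compose:
  assumes "bounded_linear L" "Ck k f" shows "Ck k (\<lambda>x. L (f x))"
  using assms(2)
proof (induction k arbitrary: f)
  case 0
  then show ?case using assms(1) by (auto intro: bounded_linear.continuous_on)
next
  case (Suc k)
  show ?case
    by (rule Ck_SucI[OF bounded_linear.has_derivative[OF assms(1) Ck_has_derivative[OF Suc.prems]]])
      (use Suc in auto)
qed

text \<open>The induction hypothesis speaks of derivatives of f in a fixed direction, but the chain
  rule produces the direction \<open>?g x v\<close>, which moves with x. Expanding it in the basis
  leaves fixed directions with scalar coefficients that are themselves of class C^k.\<close>

lemma Ck_compose:
  fixes g :: "'a::real_normed_vector \<Rightarrow> 'b::euclidean_space"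
  assumes "Ck k f" "Ck k g" shows "Ck k (\<lambda>x. f (g x))"
  using assms
proof (induction k arbitrary: f)
  case 0
  then show ?case
    by (auto intro: continuous_on_compose2)
next
  case (Suc k)
  let ?f = "\<lambda>x. frechet_derivative f (at x)" and ?g = "\<lambda>x. frechet_derivative g (at x)"
  have g: "Ck k g" using Suc.prems Ck_Suc_imp_Ck by blast
  have exp: "?f (g x) (?g x v) = (\<Sum>b\<in>Basis. (?g x v \<bullet> b) *\<^sub>R ?f (g x) b)" for x v
  proof -
    have "linear (?f (g x))"
      using Suc.prems(1) by (simp add: linear_frechet_derivative)
    then show ?thesis
      by (subst euclidean_representation[symmetric, of "?g x v"])
        (simp add: linear_sum linear_scale del: euclidean_representation)
  qed
  show ?case
  proof (rule Ck_SucI[where f' = "\<lambda>x v. ?f (g x) (?g x v)"])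
    show "((\<lambda>x. f (g x)) has_derivative (\<lambda>v. ?f (g x) (?g x v))) (at x)" for x
      using has_derivative_compose[OF Ck_has_derivative[OF Suc.prems(2)]
          Ck_has_derivative[OF Suc.prems(1)]] .
    show "Ck k (\<lambda>x. ?f (g x) (?g x v))" for v
      unfolding exp using Suc.prems g
      by (intro Ck_sum Ck_scaleR Suc.IH Ck_linear_compose[OF bounded_linear_inner_left]) auto
  qed
qed

lemma Ck_minus: "Ck k f \<Longrightarrow> Ck k (\<lambda>x. - f x)"
  by (rule Ck_linear_compose[OF bounded_linear_minus[OF bounded_linear_ident]])

lemma Ck_diff: "Ck k f \<Longrightarrow> Ck k g \<Longrightarrow> Ck k (\<lambda>x. f x - g x)"
  using Ck_add[of k f "\<lambda>x. - g x"] Ck_minus by auto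

lemma Ck_prod:
  fixes f :: "'i \<Rightarrow> 'a::real_normed_vector \<Rightarrow> 'b::real_normed_field"
  shows "(\<And>i. i \<in> I \<Longrightarrow> Ck k (f i)) \<Longrightarrow> Ck k (\<lambda>x. \<Prod>i\<in>I. f i x)"
  by (induction I rule: infinite_finite_induct) (auto intro: Ck_mult)

lemma Ck_Pair:
  assumes "Ck k f" "Ck k g" shows "Ck k (\<lambda>x. (f x, g x))"
proof -
  have "Ck k (\<lambda>x. (f x, 0) + (0, g x))"
    by (intro Ck_add Ck_linear_compose[OF bounded_linear_Pair] assms bounded_linear_zero
        bounded_linear_ident Ck_linear_compose[of "\<lambda>a. (a, 0)"] Ck_linear_compose[of "\<lambda>a. (0, a)"])
  then show ?thesis by simp
qed

section \<open>Calculation rules for directional derivatives\<close>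

lemma frechet_derivative_eqI:
  "(f has_derivative f') (at x) \<Longrightarrow> frechet_derivative f (at x) v = f' v"
  using frechet_derivative_at by metis

lemma frechet_derivative_eq_0_outside_support:
  assumes "x \<notin> closure {x. f x \<noteq> 0}"
  shows "frechet_derivative f (at x) v = 0"
proof -
  have "(f has_derivative (\<lambda>_. 0)) (at x)"
    by (rule has_derivative_transform_within_open[where f = "\<lambda>_. 0" and s = "- closure {x. f x \<noteq> 0}"])
      (use assms closure_subset[of "{x. f x \<noteq> 0}"] in auto)
  then show ?thesis by (rule frechet_derivative_eqI)
qed

lemma frechet_derivative_outside_ball:
  assumes "\<And>x. norm x > R \<Longrightarrow> f x = 0" and "norm x > R"
  shows "frechet_derivative f (at x) v = 0"
proof (rule frechet_derivative_eq_0_outside_support)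
  have "{x. f x \<noteq> 0} \<subseteq> cball 0 R"
    using assms(1) by (auto simp flip: not_less simp: mem_cball_0)
  then have "closure {x. f x \<noteq> 0} \<subseteq> cball 0 R" by (rule closure_minimal) simp
  then show "x \<notin> closure {x. f x \<noteq> 0}" using assms(2) by (auto simp: mem_cball_0)
qed

lemma frechet_derivative_add:
  assumes "f differentiable (at x)" "g differentiable (at x)"
  shows "frechet_derivative (\<lambda>x. f x + g x) (at x) v =
    frechet_derivative f (at x) v + frechet_derivative g (at x) v"
  using assms by (intro frechet_derivative_eqI has_derivative_add) (auto simp: frechet_derivative_works)

lemma (in bounded_linear) frechet_derivative_linear:
  assumes "g differentiable (at x)"
  shows "frechet_derivative (\<lambda>x. f (g x)) (at x) v = f (frechet_derivative g (at x) v)"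
  using assms by (intro frechet_derivative_eqI has_derivative) (auto simp: frechet_derivative_works)

lemma frechet_derivative_mult:
  fixes f g :: "'a::real_normed_vector \<Rightarrow> 'b::real_normed_algebra"
  assumes "f differentiable (at x)" "g differentiable (at x)"
  shows "frechet_derivative (\<lambda>x. f x * g x) (at x) v =
    f x * frechet_derivative g (at x) v + frechet_derivative f (at x) v * g x"
  using assms by (intro frechet_derivative_eqI has_derivative_mult) (auto simp: frechet_derivative_works)

lemma Ck_derivative_along_line:
  assumes "Ck (Suc k) f"
  shows "((\<lambda>t. f (x + t *\<^sub>R v)) has_vector_derivative frechet_derivative f (at (x + t *\<^sub>R v)) v)
    (at t within S)"
proof -
  have "((\<lambda>t. f (x + t *\<^sub>R v)) has_derivative
      (\<lambda>h. frechet_derivative f (at (x + t *\<^sub>R v)) (h *\<^sub>R v))) (at t within S)"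
    by (rule has_derivative_compose[OF _ Ck_has_derivative[OF assms]])
      (auto intro!: derivative_eq_intros)
  moreover have "linear (frechet_derivative f (at (x + t *\<^sub>R v)))"
    using assms by (simp add: linear_frechet_derivative)
  ultimately show ?thesis
    by (simp add: has_vector_derivative_def linear_scale)
qed


text \<open>The increment f(x + av + bw) - f(x + av) is the integral over t in [0, b] of the
  w-derivative of f at x + av + tw. Differentiating in a at 0 under the integral gives the increment
  of the v-derivative along w as an integral of the mixed derivative; differentiating that in b at 0
  gives the claim. Since the integral runs over {0..b} with b \<ge> 0, the last derivative is taken
  one-sidedly.\<close>

lemma frechet_derivative_commute:
  fixes f :: "'a::euclidean_space \<Rightarrow> 'b::euclidean_space"
  assumes f: "Ck (Suc (Suc k)) f"
  shows "frechet_derivative (\<lambda>y. frechet_derivative f (at y) v) (at x) w =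
    frechet_derivative (\<lambda>y. frechet_derivative f (at y) w) (at x) v"
proof -
  define Dv where "Dv = (\<lambda>y. frechet_derivative f (at y) v)"
  define Dw where "Dw = (\<lambda>y. frechet_derivative f (at y) w)"
  define DvDw where "DvDw = (\<lambda>y. frechet_derivative Dw (at y) v)"
  have f1: "Ck (Suc k) f" using Ck_Suc_imp_Ck[OF f] .
  have C: "Ck (Suc k) Dv" "Ck (Suc k) Dw"
    unfolding Dv_def Dw_def by (rule Ck_frechet_derivative[OF f])+
  have contD: "continuous_on UNIV DvDw" "continuous_on UNIV Dw"
    using Ck_imp_continuous_on[OF Ck_frechet_derivative[OF C(2)]] Ck_imp_continuous_on[OF C(2)]
    by (auto simp: DvDw_def)
  note [continuous_intros] = continuous_on_compose2[OF contD(1)] continuous_on_compose2[OF contD(2)]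
  have FTC: "integral {0..b} (\<lambda>t. Dw (x + a *\<^sub>R v + t *\<^sub>R w)) =
      f (x + a *\<^sub>R v + b *\<^sub>R w) - f (x + a *\<^sub>R v)" if "b \<ge> 0" for a b
    using fundamental_theorem_of_calculus[OF that, of "\<lambda>t. f (x + a *\<^sub>R v + t *\<^sub>R w)"]
      Ck_derivative_along_line[OF f1, of "x + a *\<^sub>R v" w]
    by (simp add: Dw_def integral_unique)
  have eq: "integral {0..b} (\<lambda>t. DvDw (x + t *\<^sub>R w)) = Dv (x + b *\<^sub>R w) - Dv x"
    if b: "b \<ge> 0" for b
  proof -
    have "((\<lambda>a. integral (cbox 0 b) (\<lambda>t. Dw (x + a *\<^sub>R v + t *\<^sub>R w))) has_vector_derivative
        integral (cbox 0 b) (\<lambda>t. DvDw (x + 0 *\<^sub>R v + t *\<^sub>R w))) (at 0 within UNIV)"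
    proof (rule leibniz_rule_vector_derivative)
      show "((\<lambda>a. Dw (x + a *\<^sub>R v + t *\<^sub>R w)) has_vector_derivative DvDw (x + a *\<^sub>R v + t *\<^sub>R w))
          (at a within UNIV)" for a t
        using Ck_derivative_along_line[OF C(2), of "x + t *\<^sub>R w" v a]
        by (simp add: DvDw_def algebra_simps)
      show "(\<lambda>t. Dw (x + a *\<^sub>R v + t *\<^sub>R w)) integrable_on cbox 0 b" for a
        by (intro integrable_continuous continuous_intros) auto
      show "continuous_on (UNIV \<times> cbox 0 b) (\<lambda>(a, t). DvDw (x + a *\<^sub>R v + t *\<^sub>R w))"
        unfolding split_beta by (intro continuous_intros) auto
    qed auto
    then have A: "((\<lambda>a. f (x + a *\<^sub>R v + b *\<^sub>R w) - f (x + a *\<^sub>R v)) has_vector_derivative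
        integral {0..b} (\<lambda>t. DvDw (x + t *\<^sub>R w))) (at 0)"
      using FTC[OF b] by simp
    have "((\<lambda>a. f ((x + b *\<^sub>R w) + a *\<^sub>R v) - f (x + a *\<^sub>R v)) has_vector_derivative
        Dv ((x + b *\<^sub>R w) + 0 *\<^sub>R v) - Dv (x + 0 *\<^sub>R v)) (at 0)"
      unfolding Dv_def by (intro derivative_intros Ck_derivative_along_line[OF f1])
    then have "((\<lambda>a. f (x + a *\<^sub>R v + b *\<^sub>R w) - f (x + a *\<^sub>R v)) has_vector_derivative
        Dv (x + b *\<^sub>R w) - Dv x) (at 0)"
      by (simp add: add_ac)
    with A show ?thesis by (rule vector_derivative_unique_at)
  qed
  have "((\<lambda>b. Dv (x + b *\<^sub>R w) - Dv x) has_vector_derivative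
      frechet_derivative Dv (at (x + 0 *\<^sub>R w)) w - 0) (at 0 within {0..1})"
    by (intro derivative_intros Ck_derivative_along_line[OF C(1)])
  moreover have "((\<lambda>b. integral {0..b} (\<lambda>t. DvDw (x + t *\<^sub>R w))) has_vector_derivative
      DvDw (x + 0 *\<^sub>R w)) (at 0 within {0..1})"
    by (rule integral_has_vector_derivative) (auto intro!: continuous_intros)
  then have "((\<lambda>b. Dv (x + b *\<^sub>R w) - Dv x) has_vector_derivative
      DvDw (x + 0 *\<^sub>R w)) (at 0 within {0..1})"
    by (rule has_vector_derivative_transform[rotated 2]) (auto simp: eq)
  moreover have "at (0::real) within {0..1} \<noteq> bot"
    by (simp add: at_within_Icc_at_right)
  ultimately show ?thesis
    using vector_derivative_unique_within by (fastforce simp: Dv_def Dw_def DvDw_def)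
qed


subsection \<open>Integrals depending on a parameter\<close>

definition locally_integrable :: "('a::euclidean_space \<Rightarrow> complex) \<Rightarrow> bool" where
  "locally_integrable s \<longleftrightarrow> s \<in> borel_measurable borel \<and>
     (\<forall>r. integrable lborel (\<lambda>y. indicator (cball 0 r) y * norm (s y)))"

text \<open>Here x is the parameter and y the integration variable. A kernel \<phi>(y x^-1) has no
  compact support in (x, y) jointly; what it has is a support on which y stays bounded as long as x
  does.\<close>

definition proper_kernel ::
  "('a::euclidean_space \<times> 'b::euclidean_space \<Rightarrow> complex) \<Rightarrow> bool" where
  "proper_kernel K \<longleftrightarrow> (\<forall>r. \<exists>R. \<forall>x y. norm x \<le> r \<longrightarrow> R < norm y \<longrightarrow> K (x, y) = 0)"

lemma proper_kernelE:
  assumes "proper_kernel K"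
  obtains R where "\<And>x y. norm x \<le> r \<Longrightarrow> R < norm y \<Longrightarrow> K (x, y) = 0"
  using assms unfolding proper_kernel_def by meson

lemma locally_integrable_const [simp]: "locally_integrable (\<lambda>_. c)"
proof -
  have "integrable lborel (indicator (cball 0 r) :: 'a \<Rightarrow> real)" for r
    by (intro integrable_real_indicator emeasure_lborel_cball_finite) simp
  then show ?thesis
    by (auto simp: locally_integrable_def)
qed

lemma integrable_mult_locally_integrable:
  assumes s: "locally_integrable s" and g: "g \<in> borel_measurable borel"
    and bd: "\<And>y. norm (g y) \<le> M * indicator (cball 0 r) y"
  shows "integrable lborel (\<lambda>y. g y * s y)"
proof (rule Bochner_Integration.integrable_bound)
  show "integrable lborel (\<lambda>y. M * (indicator (cball 0 r) y * norm (s y)))"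
    using s by (auto simp: locally_integrable_def)
  show "(\<lambda>y. g y * s y) \<in> borel_measurable lborel"
    using s g by (auto simp: locally_integrable_def)
  show "AE y in lborel. norm (g y * s y) \<le> norm (M * (indicator (cball 0 r) y * norm (s y)))"
  proof (rule AE_I2)
    fix y
    have "norm (g y * s y) \<le> M * indicator (cball 0 r) y * norm (s y)"
      unfolding norm_mult by (rule mult_right_mono[OF bd]) auto
    then show "norm (g y * s y) \<le> norm (M * (indicator (cball 0 r) y * norm (s y)))"
      by (simp add: mult.assoc)
  qed
qed

lemma continuous_on_bounded_cball:
  fixes f :: "'a::euclidean_space \<Rightarrow> 'b::real_normed_vector"
  assumes "continuous_on UNIV f"
  obtains M where "M \<ge> 0" "\<And>x. norm x \<le> r \<Longrightarrow> norm (f x) \<le> M"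
proof -
  have "compact (f ` cball 0 r)"
    using assms continuous_on_subset by (intro compact_continuous_image) auto
  then obtain M where "\<forall>y\<in>f ` cball 0 r. norm y \<le> M"
    using compact_imp_bounded bounded_iff by metis
  then have "norm (f x) \<le> max M 0" if "norm x \<le> r" for x
    using that by (auto simp: le_max_iff_disj)
  then show ?thesis using that[of "max M 0"] by auto
qed

lemma kernel_bound:
  assumes K: "continuous_on UNIV K" "proper_kernel K"
  obtains M R where "M \<ge> 0"
    "\<And>x y. norm x \<le> r \<Longrightarrow> norm (K (x, y)) \<le> M * indicator (cball 0 R) y"
proof -
  obtain R where R: "\<And>x y. norm x \<le> r \<Longrightarrow> R < norm y \<Longrightarrow> K (x, y) = 0"
    by (rule proper_kernelE[OF K(2), where r = r]) blast
  obtain M where M: "M \<ge> 0" "\<And>p. norm p \<le> r + R \<Longrightarrow> norm (K p) \<le> M"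
    using continuous_on_bounded_cball[OF K(1)] by metis
  have "norm (K (x, y)) \<le> M * indicator (cball 0 R) y" if "norm x \<le> r" for x y
  proof (cases "norm y \<le> R")
    case True
    then have "norm (x, y) \<le> r + R"
      using that norm_Pair_le[of x y] by linarith
    then show ?thesis using M True by auto
  next
    case False
    then show ?thesis using R[OF that] by auto
  qed
  then show ?thesis using that M(1) by blast
qed

lemma kernel_slice_measurable:
  assumes "continuous_on UNIV K" shows "(\<lambda>y. K (x, y)) \<in> borel_measurable borel"
  by (intro borel_measurable_continuous_onI continuous_on_compose2[OF assms]) (auto intro: continuous_intros)

lemma integrable_kernel:
  assumes K: "continuous_on UNIV K" "proper_kernel K" and s: "locally_integrable s"
  shows "integrable lborel (\<lambda>y. K (x, y) * s y)"
proof -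
  obtain M R where "\<And>y. norm (K (x, y)) \<le> M * indicator (cball 0 R) y"
    using kernel_bound[OF K, of "norm x"] by (metis order_refl)
  then show ?thesis
    by (rule integrable_mult_locally_integrable[OF s kernel_slice_measurable[OF K(1)]])
qed

text \<open>A derivative sees a whole neighbourhood, so the bound for parameters of norm at most r
  is taken from the radius r + 1: there K vanishes on an open set around (x, y).\<close>

lemma proper_kernel_frechet_derivative:
  assumes "proper_kernel K"
  shows "proper_kernel (\<lambda>p. frechet_derivative K (at p) v)"
  unfolding proper_kernel_def
proof
  fix r
  obtain R where R: "\<And>x y. norm x \<le> r + 1 \<Longrightarrow> R < norm y \<Longrightarrow> K (x, y) = 0"
    by (rule proper_kernelE[OF assms, where r = "r + 1"]) blast
  have "frechet_derivative K (at (x, y)) v = 0" if "norm x \<le> r" "R < norm y" for x y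
  proof (rule frechet_derivative_eq_0_outside_support)
    have "open (ball 0 (r + 1) \<times> (- cball 0 R))"
      by (intro open_Times) auto
    then have "closed (- (ball 0 (r + 1) \<times> (- cball 0 R)))"
      by (simp add: closed_def)
    moreover have "{p. K p \<noteq> 0} \<subseteq> - (ball 0 (r + 1) \<times> (- cball 0 R))"
      using R by fastforce
    ultimately have "closure {p. K p \<noteq> 0} \<subseteq> - (ball 0 (r + 1) \<times> (- cball 0 R))"
      by (rule closure_minimal[rotated])
    moreover have "(x, y) \<in> ball 0 (r + 1) \<times> (- cball 0 R)"
      using that by auto
    ultimately show "(x, y) \<notin> closure {p. K p \<noteq> 0}" by blast
  qed
  then show "\<exists>R. \<forall>x y. norm x \<le> r \<longrightarrow> R < norm y \<longrightarrow> frechet_derivative K (at (x, y)) v = 0"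
    by blast
qed

lemma has_derivative_slice:
  assumes "Ck (Suc k) K"
  shows "((\<lambda>x. K (x, y)) has_derivative (\<lambda>v. frechet_derivative K (at (x, y)) (v, 0))) (at x within S)"
  by (rule has_derivative_compose[OF _ Ck_has_derivative[OF assms]])
    (auto intro!: derivative_eq_intros)

text \<open>As s is merely locally integrable, the difference quotients are controlled by dominated
  convergence along sequences. Near x all of them live on one common ball in y and are bounded by a
  constant there, so a multiple of |s| on this ball is a majorant.\<close>

lemma has_derivative_kernel_integral:
  assumes K: "Ck (Suc k) K" and supp: "proper_kernel K" and s: "locally_integrable s"
  shows "((\<lambda>x. LINT y|lborel. K (x, y) * s y) has_derivative
    (\<lambda>v. LINT y|lborel. frechet_derivative K (at (x, y)) (v, 0) * s y)) (at x)"
proof -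
  define D where "D = (\<lambda>v p. frechet_derivative K (at p) (v, 0))"
  let ?S = "\<lambda>x. LINT y|lborel. K (x, y) * s y"
  let ?S' = "\<lambda>v. LINT y|lborel. D v (x, y) * s y"
  have contK: "continuous_on UNIV K" and contD: "continuous_on UNIV (D v)" for v
    using K Ck_imp_continuous_on[of k "D v"] Ck_imp_continuous_on[OF K] by (auto simp: D_def)
  have suppD: "proper_kernel (D v)" for v
    unfolding D_def by (rule proper_kernel_frechet_derivative[OF supp])
  have lin: "linear (frechet_derivative K (at p))" for p
    using K linear_frechet_derivative unfolding Ck.simps by blast
  have Dadd: "D (v + w) p = D v p + D w p" and Dscale: "D (c *\<^sub>R v) p = c *\<^sub>R D v p" for v w c p
    using linear_add[OF lin, of p "(v, 0)" "(w, 0)"] linear_scale[OF lin, of p c "(v, 0)"]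
    by (auto simp: D_def)
  have linD: "linear (\<lambda>v. D v p)" for p
    by (rule linearI) (auto simp: Dadd Dscale)
  note int = integrable_kernel[OF contK supp s] integrable_kernel[OF contD suppD s]
  have "\<exists>M R. M \<ge> 0 \<and> (\<forall>x' y. norm x' \<le> norm x + 1 \<longrightarrow>
      norm (D b (x', y)) \<le> M * indicator (cball 0 R) y)" for b
    by (rule kernel_bound[OF contD suppD, where r = "norm x + 1"]) blast
  then obtain N R where N: "\<And>b. N b \<ge> 0"
      "\<And>b x' y. norm x' \<le> norm x + 1 \<Longrightarrow> norm (D b (x', y)) \<le> N b * indicator (cball 0 (R b)) y"
    by metis
  \<comment> \<open>The derivative is controlled in all directions by the finitely many basis
    directions: their bounds are added up and their supporting balls are replaced by the largest
    one.\<close>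
  define M where "M = (\<Sum>b\<in>Basis. N b)"
  define R' where "R' = (MAX b\<in>Basis. R b)"
  have bdD: "norm (D v (x', y)) \<le> M * indicator (cball 0 R') y * norm v"
    if x': "norm x' \<le> norm x + 1" for v x' y
  proof -
    have "D v (x', y) = (\<Sum>b\<in>Basis. (v \<bullet> b) *\<^sub>R D b (x', y))"
      by (subst euclidean_representation[symmetric, of v])
        (simp add: linear_sum[OF linD] linear_scale[OF linD] del: euclidean_representation)
    also have "norm \<dots> \<le> (\<Sum>b\<in>Basis. norm v * (N b * indicator (cball 0 R') y))"
    proof (rule sum_norm_le)
      fix b :: 'a assume b: "b \<in> Basis"
      have "R b \<le> R'" unfolding R'_def using b by (intro Max_ge) auto
      then have "(indicator (cball 0 (R b)) y :: real) \<le> indicator (cball 0 R') y"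
        by (auto split: split_indicator)
      then have "norm (D b (x', y)) \<le> N b * indicator (cball 0 R') y"
        using N(2)[OF x', of b y] N(1)[of b] by (meson mult_left_mono order_trans)
      then show "norm ((v \<bullet> b) *\<^sub>R D b (x', y)) \<le> norm v * (N b * indicator (cball 0 R') y)"
        using Basis_le_norm[OF b] by (auto intro!: mult_mono)
    qed
    also have "\<dots> = M * indicator (cball 0 R') y * norm v"
      unfolding M_def sum_distrib_right by (intro sum.cong) (simp_all only: mult_ac)
    finally show ?thesis .
  qed
  have bdK: "norm (K (x + h, y) - K (x, y)) \<le> M * indicator (cball 0 R') y * norm h"
    if "norm h \<le> 1" for h y
  proof -
    have "norm (K (x + h, y) - K (x, y)) \<le> (M * indicator (cball 0 R') y) * norm ((x + h) - x)"
    proof (rule differentiable_bound[of "cball x 1"])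
      show "((\<lambda>x. K (x, y)) has_derivative (\<lambda>v. D v (x', y))) (at x' within cball x 1)" for x'
        unfolding D_def by (rule has_derivative_slice[OF K])
      show "onorm (\<lambda>v. D v (x', y)) \<le> M * indicator (cball 0 R') y" if "x' \<in> cball x 1" for x'
      proof (rule onorm_le)
        have "norm x' \<le> norm x + 1"
          using that norm_triangle_ineq2[of x' x] by (auto simp: dist_norm norm_minus_commute)
        then show "norm (D v (x', y)) \<le> M * indicator (cball 0 R') y * norm v" for v
          by (rule bdD)
      qed
    qed (use that in \<open>auto simp: dist_norm\<close>)
    then show ?thesis by simp
  qed
  have lim: "(\<lambda>n. norm (?S (x + X n) - ?S x - ?S' (X n)) / norm (X n)) \<longlonglongrightarrow> 0"
    if X: "\<And>n. X n \<noteq> 0" "\<And>n. norm (X n) \<le> 1" "X \<longlonglongrightarrow> 0" for X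
  proof -
    \<comment> \<open>The remainder divided by the length of the increment. One \<open>M\<close>
      bounds the increment of K by the mean value inequality, a second one the linear term; hence
      the factor 2 below.\<close>
    define Q where "Q = (\<lambda>n y. (1 / norm (X n)) *\<^sub>R (K (x + X n, y) - K (x, y) - D (X n) (x, y)))"
    have Qbd: "norm (Q n y) \<le> (2 * M) * indicator (cball 0 R') y" for n y
    proof -
      have "norm (K (x + X n, y) - K (x, y) - D (X n) (x, y)) \<le>
          (2 * M) * indicator (cball 0 R') y * norm (X n)"
        using bdK[OF X(2), of n y] bdD[of x "X n" y]
          norm_triangle_ineq4[of "K (x + X n, y) - K (x, y)" "D (X n) (x, y)"] by auto
      then show ?thesis
        using X(1)[of n] by (simp add: Q_def divide_simps)
    qed
    have Qm: "Q n \<in> borel_measurable borel" for n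
      unfolding Q_def by (intro borel_measurable_scaleR borel_measurable_diff
          kernel_slice_measurable contK contD borel_measurable_const)
    have "(\<lambda>n. LINT y|lborel. Q n y * s y) \<longlonglongrightarrow> (LINT y::'b|lborel. 0)"
    proof (rule integral_dominated_convergence[where
          w = "\<lambda>y. 2 * M * (indicator (cball 0 R') y * norm (s y))"])
      show "integrable lborel (\<lambda>y. 2 * M * (indicator (cball 0 R') y * norm (s y)))"
        by (rule integrable_mult_right) (use s in \<open>simp add: locally_integrable_def\<close>)
      show "(\<lambda>y. Q n y * s y) \<in> borel_measurable lborel" for n
        using Qm[of n] s by (auto simp: locally_integrable_def)
      show "AE y in lborel. norm (Q n y * s y) \<le> 2 * M * (indicator (cball 0 R') y * norm (s y))" for n
        using mult_right_mono[OF Qbd[of n] norm_ge_zero] by (auto simp: norm_mult mult.assoc)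
      show "AE y in lborel. (\<lambda>n. Q n y * s y) \<longlonglongrightarrow> 0"
      proof (rule AE_I2)
        fix y
        have "((\<lambda>h. norm (K (x + h, y) - K (x, y) - D h (x, y)) / norm h) \<longlongrightarrow> 0) (at 0)"
          using has_derivative_slice[OF K, of y x UNIV] by (simp add: has_derivative_at D_def)
        then have "(\<lambda>n. norm (Q n y)) \<longlonglongrightarrow> 0"
          unfolding tendsto_at_iff_sequentially comp_def Q_def using X(1,3) by auto
        then have "(\<lambda>n. Q n y) \<longlonglongrightarrow> 0" by (rule tendsto_norm_zero_cancel)
        from tendsto_mult_left_zero[OF this] show "(\<lambda>n. Q n y * s y) \<longlonglongrightarrow> 0" .
      qed
    qed auto
    moreover have "(LINT y|lborel. Q n y * s y) = (?S (x + X n) - ?S x - ?S' (X n)) /\<^sub>R norm (X n)" for n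
    proof -
      have "Q n y * s y = (1 / norm (X n)) *\<^sub>R
          (K (x + X n, y) * s y - K (x, y) * s y - D (X n) (x, y) * s y)" for y
        by (simp add: Q_def algebra_simps)
      then show ?thesis
        by (simp add: int divide_inverse)
    qed
    ultimately have "(\<lambda>n. (?S (x + X n) - ?S x - ?S' (X n)) /\<^sub>R norm (X n)) \<longlonglongrightarrow> 0"
      by simp
    from tendsto_norm_zero[OF this]
    have "(\<lambda>n. norm ((?S (x + X n) - ?S x - ?S' (X n)) /\<^sub>R norm (X n))) \<longlonglongrightarrow> 0"
      by simp
    then show ?thesis by (simp add: divide_inverse mult.commute)
  qed
  have "(?S has_derivative ?S') (at x)"
    unfolding has_derivative_at
  proof
    have "linear ?S'"
      by (rule linearI) (auto simp: Dadd Dscale int distrib_right)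
    then show "bounded_linear ?S'" by (simp add: linear_linear)
    show "(\<lambda>h. norm (?S (x + h) - ?S x - ?S' h) / norm h) \<midarrow>0\<rightarrow> 0"
      unfolding tendsto_at_iff_sequentially comp_def
    proof (intro allI impI)
      fix X :: "nat \<Rightarrow> 'a" assume X: "\<forall>i. X i \<in> UNIV - {0}" "X \<longlonglongrightarrow> 0"
      then obtain N where N: "\<And>n. n \<ge> N \<Longrightarrow> norm (X n) < 1"
        using LIMSEQ_iff[of X 0] by (metis diff_zero zero_less_one)
      show "(\<lambda>n. norm (?S (x + X n) - ?S x - ?S' (X n)) / norm (X n)) \<longlonglongrightarrow> 0"
        by (rule LIMSEQ_offset[where k = N], rule lim)
          (use X N[THEN less_imp_le] LIMSEQ_ignore_initial_segment[OF X(2), of N] in auto)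
    qed
  qed
  then show ?thesis by (simp add: D_def)
qed

text \<open>One order is given away because the base case obtains continuity from differentiability.
  The kernels used later are smooth, so the loss is harmless.\<close>

lemma Ck_kernel_integral:
  assumes "Ck (Suc k) K" "proper_kernel K" "locally_integrable s"
  shows "Ck k (\<lambda>x. LINT y|lborel. K (x, y) * s y)"
  using assms(1,2)
proof (induction k arbitrary: K)
  case 0
  have "(\<lambda>x. LINT y|lborel. K (x, y) * s y) differentiable_on UNIV"
    using has_derivative_kernel_integral[OF 0 assms(3)]
    unfolding differentiable_on_def differentiable_def by blast
  then show ?case using differentiable_imp_continuous_on by auto
next
  case (Suc k)
  show ?case
    by (rule Ck_SucI[OF has_derivative_kernel_integral[OF Suc.prems assms(3)]])
      (intro Suc.IH Ck_frechet_derivative proper_kernel_frechet_derivative Suc.prems)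
qed

section \<open>Translation invariance and integrals of derivatives\<close>

lemma LINT_lborel_translate:
  fixes f :: "'a::euclidean_space \<Rightarrow> complex"
  assumes "f \<in> borel_measurable borel"
  shows "(LINT y|lborel. f (x + y)) = (LINT y|lborel. f y)"
proof -
  have "(LINT y|lborel. f y) = (LINT y|distr lborel borel ((+) x). f y)"
    by (simp add: lborel_distr_plus)
  also have "\<dots> = (LINT y|lborel. f (x + y))"
    using assms by (intro integral_distr) auto
  finally show ?thesis ..
qed

text \<open>The integral of f(x + y) over y does not depend on x. Differentiating it at x = 0 under
  the integral, with the constant 1 in the role of s, gives the claim.\<close>

lemma integral_frechet_derivative_eq_0:
  fixes f :: "'a::euclidean_space \<Rightarrow> complex"
  assumes f: "Ck (Suc 0) f" and supp: "\<And>x. norm x > R \<Longrightarrow> f x = 0"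
  shows "(LINT x|lborel. frechet_derivative f (at x) v) = 0"
proof -
  let ?K = "\<lambda>p. f (fst p + snd p)"
  have K: "Ck (Suc 0) ?K"
    by (intro Ck_compose[OF f] Ck_add Ck_bounded_linear bounded_linear_fst bounded_linear_snd)
  have p: "proper_kernel ?K"
    unfolding proper_kernel_def
  proof (intro allI exI impI)
    fix r :: real and x y :: 'a assume "norm x \<le> r" "R + r < norm y"
    then have "norm (x + y) > R" using norm_diff_ineq[of y x] by (simp add: add.commute)
    then show "?K (x, y) = 0" using supp by simp
  qed
  have DK: "frechet_derivative ?K (at (0, y)) (v, 0) = frechet_derivative f (at y) v" for y
  proof (rule frechet_derivative_eqI[where f' = "\<lambda>w. frechet_derivative f (at y) (fst w + snd w)", THEN trans])
    show "(?K has_derivative (\<lambda>w. frechet_derivative f (at y) (fst w + snd w))) (at (0, y))"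
      by (rule has_derivative_compose[where g = f])
        (use Ck_has_derivative[OF f, of y] in \<open>auto intro!: derivative_eq_intros\<close>)
  qed simp
  have "f \<in> borel_measurable borel"
    using Ck_imp_continuous_on[OF f] by (rule borel_measurable_continuous_onI)
  then have "(\<lambda>x. LINT y|lborel. ?K (x, y) * 1) = (\<lambda>x. LINT y|lborel. f y)"
    using LINT_lborel_translate[of f] by simp
  then have "((\<lambda>x. LINT y|lborel. f y) has_derivative
      (\<lambda>v. LINT y|lborel. frechet_derivative ?K (at (0, y)) (v, 0) * 1)) (at 0)"
    using has_derivative_kernel_integral[OF K p locally_integrable_const[of 1], of 0] by simp
  then have "(\<lambda>v. LINT y|lborel. frechet_derivative ?K (at (0, y)) (v, 0) * 1) = (\<lambda>v. 0)"
    by (rule has_derivative_unique) simp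
  from fun_cong[OF this, of v] show ?thesis by (simp add: DK)
qed


subsection \<open>Bump functions and the fundamental lemma of the calculus of variations\<close>

text \<open>The polynomial parameter makes the family closed under differentiation: the derivative
  replaces p by X^2 (p - p'). Smoothness then follows by a single induction over all p, with p = 1
  the usual flat function exp(-1/x).\<close>

definition flat :: "real poly \<Rightarrow> real \<Rightarrow> real" where
  "flat p x = (if x > 0 then poly p (1 / x) * exp (- (1 / x)) else 0)"

lemma poly_mult_exp_tendsto_0: "((\<lambda>t. poly p t * exp (- t)) \<longlongrightarrow> (0::real)) at_top"
proof -
  have "((\<lambda>t. \<Sum>i\<le>degree p. coeff p i * (t ^ i / exp t)) \<longlongrightarrow> (\<Sum>i\<le>degree p. coeff p i * 0)) at_top"
    by (intro tendsto_intros tendsto_power_div_exp_0)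
  moreover have "(\<Sum>i\<le>degree p. coeff p i * (t ^ i / exp t)) = poly p t * exp (- t)" for t
    by (simp add: poly_altdef exp_minus sum_distrib_right divide_inverse mult.assoc)
  ultimately show ?thesis by simp
qed

lemma flat_tendsto_0: "(flat p \<longlongrightarrow> 0) (at 0)"
proof -
  have "((\<lambda>x. poly p (inverse x) * exp (- inverse x)) \<longlongrightarrow> 0) (at_right 0)"
    by (rule filterlim_compose[OF poly_mult_exp_tendsto_0 filterlim_inverse_at_top_right])
  then have "(flat p \<longlongrightarrow> 0) (at_right 0)"
    by (rule Lim_transform_eventually)
      (auto simp: flat_def eventually_at_right_less inverse_eq_divide
        intro!: eventually_mono[OF eventually_at_right_less])
  moreover have "(flat p \<longlongrightarrow> 0) (at_left 0)"
    by (rule tendsto_eventually)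
      (auto simp: flat_def intro!: eventually_mono[OF eventually_at_left_real[of "-1" 0]])
  ultimately show ?thesis
    by (rule filterlim_split_at[rotated])
qed

lemma flat_has_derivative:
  "(flat p has_real_derivative flat ([:0, 0, 1:] * (p - pderiv p)) x) (at x)"
proof (cases x "0 :: real" rule: linorder_cases)
  case less
  have "(flat p has_real_derivative 0) (at x)"
    by (rule has_field_derivative_transform_within[where f = "\<lambda>_. 0" and d = "- x"])
      (use less in \<open>auto simp: flat_def dist_real_def\<close>)
  then show ?thesis using less by (simp add: flat_def)
next
  case equal
  have "((\<lambda>h. (flat p (0 + h) - flat p 0) / h) \<longlongrightarrow> 0) (at 0)"
  \<comment> \<open>Dividing by h amounts to multiplying the polynomial in 1/h by X, so the
    difference quotient at 0 is again a member of the family.\<close>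
  proof (rule Lim_transform_eventually[OF flat_tendsto_0[of "[:0, 1:] * p"]])
    show "\<forall>\<^sub>F h in at 0. flat ([:0, 1:] * p) h = (flat p (0 + h) - flat p 0) / h"
      by (auto simp: flat_def eventually_at_filter)
  qed
  then show ?thesis
    using equal by (simp add: DERIV_def flat_def)
next
  case greater
  have "((\<lambda>x. poly p (1 / x) * exp (- (1 / x))) has_real_derivative
      flat ([:0, 0, 1:] * (p - pderiv p)) x) (at x)"
    using greater
    by (auto intro!: derivative_eq_intros DERIV_chain2[OF poly_DERIV]
        simp: flat_def field_simps power2_eq_square)
  then show ?thesis
    by (rule has_field_derivative_transform_within[where d = x]) (use greater in \<open>auto simp: flat_def dist_real_def\<close>)
qed

lemma Ck_flat: "Ck k (flat p)"
proof (induction k arbitrary: p)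
  case 0
  show ?case
    using DERIV_isCont[OF flat_has_derivative] by (auto simp: continuous_on_eq_continuous_at)
next
  case (Suc k)
  show ?case
    by (rule Ck_SucI[OF flat_has_derivative[unfolded has_field_derivative_def]])
      (intro Ck_mult Suc Ck_const)
qed

text \<open>As m grows, every factor tends to 1 inside the open box, while all bumps vanish outside
  it. They converge pointwise to the indicator of the box and are dominated by it.\<close>

definition box_bump :: "'a::euclidean_space \<Rightarrow> 'a \<Rightarrow> real \<Rightarrow> 'a \<Rightarrow> real" where
  "box_bump a b m x =
     (\<Prod>i\<in>Basis. flat 1 (m * (x \<bullet> i - a \<bullet> i)) * flat 1 (m * (b \<bullet> i - x \<bullet> i)))"

lemma flat_1_bounds: "0 \<le> flat 1 x" "flat 1 x \<le> 1"
  by (auto simp: flat_def)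

lemma Ck_box_bump: "Ck k (box_bump a b m)"
  unfolding box_bump_def
  by (intro Ck_prod Ck_mult Ck_compose[OF Ck_flat] Ck_diff Ck_const
      Ck_bounded_linear bounded_linear_inner_left)

lemma box_bump_eq_0:
  assumes "m > 0" "x \<notin> box a b" shows "box_bump a b m x = 0"
proof -
  obtain i where "i \<in> Basis" "x \<bullet> i \<le> a \<bullet> i \<or> b \<bullet> i \<le> x \<bullet> i"
    using assms(2) by (force simp: mem_box)
  moreover then have "m * (x \<bullet> i - a \<bullet> i) \<le> 0 \<or> m * (b \<bullet> i - x \<bullet> i) \<le> 0"
    using assms(1) by (auto simp: mult_le_0_iff)
  ultimately show ?thesis
    unfolding box_bump_def by (auto simp: flat_def intro!: bexI[of _ i])
qed

lemma box_bump_bounds: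
  assumes "m > 0" shows "\<bar>box_bump a b m x\<bar> \<le> indicator (box a b) x"
proof (cases "x \<in> box a b")
  case True
  have "0 \<le> box_bump a b m x \<and> box_bump a b m x \<le> 1"
    unfolding box_bump_def using flat_1_bounds
    by (intro conjI prod_nonneg prod_le_1) (auto intro!: mult_le_one)
  then show ?thesis using True by auto
qed (simp add: box_bump_eq_0 assms)

lemma box_bump_tendsto:
  "(\<lambda>n. box_bump a b (real (Suc n)) x) \<longlonglongrightarrow> indicator (box a b) x"
proof (cases "x \<in> box a b")
  case True
  have f1: "(\<lambda>n. flat 1 (real (Suc n) * c)) \<longlonglongrightarrow> 1" if "c > 0" for c
  proof -
    have "(\<lambda>n. exp (- (inverse (real (Suc n)) * (1 / c)))) \<longlonglongrightarrow> exp (- (0 * (1 / c)))"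
      by (intro tendsto_intros LIMSEQ_inverse_real_of_nat)
    moreover have "exp (- (inverse (real (Suc n)) * (1 / c))) = flat 1 (real (Suc n) * c)" for n
      using that by (simp add: flat_def divide_simps)
    ultimately show ?thesis by simp
  qed
  have "(\<lambda>n. box_bump a b (real (Suc n)) x) \<longlonglongrightarrow> (\<Prod>i\<in>(Basis::'a set). 1 * 1)"
    unfolding box_bump_def using True by (intro tendsto_prod tendsto_mult f1) (auto simp: mem_box)
  then show ?thesis using True by simp
qed (simp add: box_bump_eq_0)

lemma compact_closure_box_bump_support:
  assumes "m > 0" shows "compact (closure {x. box_bump a b m x \<noteq> 0})"
proof -
  have "{x. box_bump a b m x \<noteq> 0} \<subseteq> box a b"
    using box_bump_eq_0[OF assms] by blast
  then show ?thesis
    using bounded_subset[OF bounded_box] compact_closure by blast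
qed

text \<open>Open boxes generate the Borel sets and are stable under intersection. After restriction
  to a large box s is integrable, and the sets over which its integral vanishes form a Dynkin
  system. Complements are covered because the large box is itself one of the boxes in the
  hypothesis.\<close>

lemma AE_eq_0_if_box_integrals_eq_0:
  fixes s :: "'a::euclidean_space \<Rightarrow> complex"
  assumes s: "locally_integrable s"
    and box: "\<And>a b. (LINT x|lborel. indicator (box a b) x *\<^sub>R s x) = 0"
  shows "AE x in lborel. s x = 0"
proof -
  let ?C = "\<lambda>n::nat. box (- (real n *\<^sub>R One)) (real n *\<^sub>R One) :: 'a set"
  have C: "AE x in lborel. indicator (?C n) x *\<^sub>R s x = 0" for n
  proof (rule sigma_finite_measure.density_zero[OF sigma_finite_lborel])
    define g where "g = (\<lambda>x. indicator (?C n) x *\<^sub>R s x)"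
    obtain r where r: "?C n \<subseteq> cball 0 r"
      using bounded_box[of "- (real n *\<^sub>R One)" "real n *\<^sub>R One :: 'a"]
      by (auto simp: bounded_pos subset_iff)
    have "integrable lborel (\<lambda>x. complex_of_real (indicator (?C n) x) * s x)"
      by (rule integrable_mult_locally_integrable[OF s, where M = 1 and r = r])
        (use r in \<open>auto split: split_indicator\<close>)
    then show g: "integrable lborel (\<lambda>x. indicator (?C n) x *\<^sub>R s x)"
      by (simp add: scaleR_conv_of_real)
    fix A :: "'a set" assume "A \<in> sets lborel"
    then have A: "A \<in> sigma_sets UNIV (range (\<lambda>(a, b). box a b))"
      by (simp add: borel_eq_box)
    have "Int_stable (range (\<lambda>(a, b). box a b :: 'a set))"
      by (auto simp: Int_stable_def box_Int_box)
    moreover have "range (\<lambda>(a, b). box a b :: 'a set) \<subseteq> Pow UNIV" by simp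
    moreover note A
    ultimately have "set_lebesgue_integral lborel A g = 0"
    proof (induction rule: sigma_sets_induct_disjoint)
      case (basic A)
      then obtain a b where A: "A = box a b" by auto
      obtain c d where "A \<inter> ?C n = box c d" unfolding A box_Int_box by blast
      then have "set_lebesgue_integral lborel A g = (LINT x|lborel. indicator (box c d) x *\<^sub>R s x)"
        unfolding set_lebesgue_integral_def g_def scaleR_scaleR indicator_inter_arith[symmetric]
        by simp
      then show ?case using box by simp
    next
      case (compl A)
      then have A: "A \<in> sets borel" by (simp add: borel_eq_box)
      have "set_lebesgue_integral lborel (UNIV - A) g =
          (LINT x|lborel. g x - indicator A x *\<^sub>R g x)"
        unfolding set_lebesgue_integral_def
        by (rule Bochner_Integration.integral_cong) (auto split: split_indicator)
      also have "\<dots> = (LINT x|lborel. g x) - (LINT x|lborel. indicator A x *\<^sub>R g x)"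
        using g A by (intro Bochner_Integration.integral_diff integrable_mult_indicator)
          (auto simp: g_def)
      finally show ?case
        using compl.IH box by (simp add: set_lebesgue_integral_def g_def)
    next
      case (union A)
      then have A: "A i \<in> sets borel" for i by (auto simp: borel_eq_box)
      have "set_integrable lborel (\<Union>i. A i) g"
        unfolding set_integrable_def g_def by (rule integrable_mult_indicator[OF _ g]) (use A in auto)
      then have "set_lebesgue_integral lborel (\<Union>i. A i) g = (\<Sum>i. set_lebesgue_integral lborel (A i) g)"
        using union.hyps(1) A
        by (intro lebesgue_integral_countable_add) (auto simp: disjoint_family_on_def)
      then show ?case using union.IH by simp
    qed (simp add: set_lebesgue_integral_def)
    then show "set_lebesgue_integral lborel A (\<lambda>x. indicator (?C n) x *\<^sub>R s x) = 0"
      by (simp add: g_def)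
  qed
  then have "AE x in lborel. \<forall>n. indicator (?C n) x *\<^sub>R s x = 0"
    unfolding AE_all_countable ..
  then show ?thesis
  proof (rule AE_mp, intro AE_I2 impI)
    fix x assume *: "\<forall>n. indicator (?C n) x *\<^sub>R s x = 0"
    obtain n where "x \<in> ?C n" using UN_box_eq_UNIV by blast
    with *[rule_format, of n] show "s x = 0" by simp
  qed
qed

lemma fundamental_lemma:
  fixes s :: "'a::euclidean_space \<Rightarrow> complex"
  assumes s: "locally_integrable s"
    and test: "\<And>\<phi>. (\<And>k. Ck k \<phi>) \<Longrightarrow> compact (closure {x. \<phi> x \<noteq> 0}) \<Longrightarrow>
      (LINT x|lborel. \<phi> x * s x) = 0"
  shows "AE x in lborel. s x = 0"
proof (rule AE_eq_0_if_box_integrals_eq_0[OF s])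
  fix a b :: 'a
  obtain r where r: "box a b \<subseteq> cball 0 r"
    using bounded_box[of a b] by (auto simp: bounded_pos subset_iff)
  let ?\<phi> = "\<lambda>n x. complex_of_real (box_bump a b (real (Suc n)) x)"
  have sm: "s \<in> borel_measurable borel" using s by (simp add: locally_integrable_def)
  have bm: "box_bump a b m \<in> borel_measurable borel" for m
    using Ck_imp_continuous_on[OF Ck_box_bump] by (rule borel_measurable_continuous_onI)
  have "(\<lambda>n. LINT x|lborel. ?\<phi> n x * s x) \<longlonglongrightarrow> (LINT x|lborel. indicator (box a b) x *\<^sub>R s x)"
  proof (rule integral_dominated_convergence[where w = "\<lambda>x. indicator (cball 0 r) x * norm (s x)"])
    show "AE x in lborel. (\<lambda>n. ?\<phi> n x * s x) \<longlonglongrightarrow> indicator (box a b) x *\<^sub>R s x"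
      unfolding scaleR_conv_of_real by (intro AE_I2 tendsto_intros box_bump_tendsto)
    show "AE x in lborel. norm (?\<phi> n x * s x) \<le> indicator (cball 0 r) x * norm (s x)" for n
    proof (rule AE_I2)
      fix x
      have "\<bar>box_bump a b (real (Suc n)) x\<bar> \<le> indicator (cball 0 r) x"
        using box_bump_bounds[of "real (Suc n)" a b x] r by (auto split: split_indicator_asm)
      then show "norm (?\<phi> n x * s x) \<le> indicator (cball 0 r) x * norm (s x)"
        unfolding norm_mult norm_of_real by (rule mult_right_mono) simp
    qed
    show "integrable lborel (\<lambda>x. indicator (cball 0 r) x * norm (s x))"
      using s by (simp add: locally_integrable_def)
  qed (use sm bm in measurable)
  moreover have "(LINT x|lborel. ?\<phi> n x * s x) = 0" for n
  proof (rule test)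
    show "Ck k (?\<phi> n)" for k
      by (rule Ck_linear_compose[OF bounded_linear_of_real Ck_box_bump])
    show "compact (closure {x. ?\<phi> n x \<noteq> 0})"
      using compact_closure_box_bump_support[of "real (Suc n)" a b] by simp
  qed
  ultimately show "(LINT x|lborel. indicator (box a b) x *\<^sub>R s x) = 0"
    by (simp add: LIMSEQ_const_iff)
qed


subsection \<open>Continuous functions and Lebesgue measure\<close>

lemma continuous_AE_eq_0:
  fixes f :: "'a::euclidean_space \<Rightarrow> 'b::real_normed_vector"
  assumes f: "continuous_on UNIV f" and AE: "AE x in lborel. f x = 0"
  shows "f x = 0"
proof -
  have o: "open {x. f x \<noteq> 0}"
    using f by (intro open_Collect_neq) auto
  then have "{x. f x \<noteq> 0} \<in> null_sets lborel"
    using AE by (simp add: AE_iff_null_sets)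
  then have "negligible {x. f x \<noteq> 0}"
    using null_sets_completionI negligible_iff_null_sets by blast
  then have "{x. f x \<noteq> 0} = {}"
    using o open_not_negligible by blast
  then show ?thesis by blast
qed

lemma continuous_integral_eq_0:
  fixes f :: "'a::euclidean_space \<Rightarrow> real"
  assumes "continuous_on UNIV f" "integrable lborel f" "\<And>x. f x \<ge> 0" "(LINT x|lborel. f x) \<le> 0"
  shows "f x = 0"
proof -
  have "(LINT x|lborel. f x) = 0"
    using assms(3,4) by (intro antisym integral_nonneg) auto
  then have "AE x in lborel. f x = 0"
    using assms(2,3) by (subst (asm) integral_nonneg_eq_0_iff_AE) auto
  then show ?thesis by (rule continuous_AE_eq_0[OF assms(1)])
qed

lemma integrable_continuous_bounded_support:
  fixes f :: "'a::euclidean_space \<Rightarrow> 'b::{banach,second_countable_topology}"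
  assumes "continuous_on UNIV f" "\<And>x. norm x > R \<Longrightarrow> f x = 0"
  shows "integrable lborel f"
proof -
  have "integrable lborel (\<lambda>x. indicator (cball 0 R) x *\<^sub>R f x)"
    by (rule borel_integrable_compact) (use assms(1) continuous_on_subset in auto)
  moreover have "indicator (cball 0 R) x *\<^sub>R f x = f x" for x
    using assms(2)[of x] by (auto split: split_indicator)
  ultimately show ?thesis by simp
qed

text \<open>Translation by tv preserves |u| and shifts the half-space {x. x \<bullet> v > a} by t (v
  \<bullet> v). So the mass \<open>S a\<close> of |u|^2 in this half-space does not depend on a; it
  tends to 0 as a grows and to the total mass as a decreases, and the total mass must be 0.\<close>

lemma square_integrable_translation_invariant_eq_0:
  fixes u :: "'a::euclidean_space \<Rightarrow> complex"
  assumes u: "Ck (Suc 0) u" and sq: "integrable lborel (\<lambda>x. (norm (u x))\<^sup>2)"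
    and v: "v \<noteq> 0" and D: "\<And>x. frechet_derivative u (at x) v = 0"
  shows "u x = 0"
proof -
  define f where "f = (\<lambda>x. (norm (u x))\<^sup>2)"
  have inv: "u (x + t *\<^sub>R v) = u x" for x t
  proof -
    have "((\<lambda>t. u (x + t *\<^sub>R v)) has_derivative (\<lambda>h. 0)) (at t within UNIV)" for t
      using Ck_derivative_along_line[OF u, of x v t UNIV] D by (simp add: has_vector_derivative_def)
    then have "(\<lambda>t. u (x + t *\<^sub>R v)) t = (\<lambda>t. u (x + t *\<^sub>R v)) 0"
      by (intro has_derivative_zero_unique[of UNIV]) auto
    then show ?thesis by simp
  qed
  define S where "S = (\<lambda>a. LINT x|lborel. indicator {x. x \<bullet> v > a} x * f x)"
  have cf: "continuous_on UNIV f"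
    unfolding f_def by (intro continuous_intros Ck_imp_continuous_on[OF u])
  then have fm [measurable]: "f \<in> borel_measurable borel"
    by (rule borel_measurable_continuous_onI)
  have hm [measurable]: "{x. x \<bullet> v > a} \<in> sets borel" for a
    by (intro borel_open open_Collect_less continuous_intros)
  have f0: "f x \<ge> 0" for x by (simp add: f_def)
  have fi: "integrable lborel f" using sq by (simp add: f_def)
  have shift: "S (a + t * (v \<bullet> v)) = S a" for a t
  proof -
    have "S (a + t * (v \<bullet> v)) =
        (LINT x|distr lborel borel ((+) (t *\<^sub>R v)). indicator {x. x \<bullet> v > a + t * (v \<bullet> v)} x * f x)"
      by (simp add: S_def lborel_distr_plus)
    also have "\<dots> = (LINT x|lborel. indicator {x. x \<bullet> v > a + t * (v \<bullet> v)} (t *\<^sub>R v + x) * f (t *\<^sub>R v + x))"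
      by (rule integral_distr) auto
    also have "\<dots> = S a"
      unfolding S_def f_def using inv
      by (intro Bochner_Integration.integral_cong) (auto simp: add.commute inner_simps split: split_indicator)
    finally show ?thesis .
  qed
  have vv: "v \<bullet> v > 0" using v by simp
  have lim: "(\<lambda>n. S (X n)) \<longlonglongrightarrow> (LINT x|lborel. c * f x)"
    if "\<And>x. \<forall>\<^sub>F n in sequentially. indicator {x. x \<bullet> v > X n} x = c" for X and c :: real
    unfolding S_def
  proof (rule integral_dominated_convergence[where w = f])
    show "AE x in lborel. (\<lambda>n. indicator {x. x \<bullet> v > X n} x * f x) \<longlonglongrightarrow> c * f x"
      using that by (intro AE_I2 tendsto_intros tendsto_eventually)
    show "AE x in lborel. norm (indicator {x. x \<bullet> v > X n} x * f x) \<le> f x" for n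
      using f0 by (auto split: split_indicator)
  qed (use fi in auto)
  have "(\<lambda>n. S (0 + real n * (v \<bullet> v))) \<longlonglongrightarrow> (LINT x|lborel. 0 * f x)"
  proof (rule lim)
    fix x
    have "\<forall>\<^sub>F n in sequentially. (x \<bullet> v) / (v \<bullet> v) \<le> real n"
      by (rule eventually_ge_at_top[THEN filterlim_real_sequentially[unfolded filterlim_iff, rule_format]])
    then show "\<forall>\<^sub>F n in sequentially. indicator {x. x \<bullet> v > 0 + real n * (v \<bullet> v)} x = (0::real)"
      by eventually_elim (use vv in \<open>simp add: field_simps\<close>)
  qed
  then have S0: "S 0 = 0" unfolding shift by (simp add: LIMSEQ_const_iff)
  have "(\<lambda>n. S (0 + (- real n) * (v \<bullet> v))) \<longlonglongrightarrow> (LINT x|lborel. 1 * f x)"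
  proof (rule lim)
    fix x
    have "\<forall>\<^sub>F n in sequentially. - ((x \<bullet> v) / (v \<bullet> v)) < real n"
      by (rule eventually_gt_at_top[THEN filterlim_real_sequentially[unfolded filterlim_iff, rule_format]])
    then show "\<forall>\<^sub>F n in sequentially. indicator {x. x \<bullet> v > 0 + (- real n) * (v \<bullet> v)} x = (1::real)"
      by eventually_elim (use vv in \<open>simp add: field_simps\<close>)
  qed
  then have "(LINT x|lborel. f x) = 0" unfolding shift by (simp add: S0 LIMSEQ_const_iff)
  then have "f x = 0" using cf fi f0 by (intro continuous_integral_eq_0) auto
  then show ?thesis by (simp add: f_def)
qed


subsection \<open>The vector fields\<close>

text \<open>
  \<open>hfield l \<i> j\<close> and \<open>hfield l (- \<i>) j\<close> are the vector fields \<open>Zbar\<^sub>j\<close> and \<open>Z\<^sub>j\<close> acting on functions.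
\<close>

definition field_coeff :: "('n::finite \<Rightarrow> real) \<Rightarrow> complex \<Rightarrow> 'n \<Rightarrow> 'n heis \<Rightarrow> complex" where
  "field_coeff l c j x =
     c * of_real (l j) * (of_real (Re (fst x $ j)) + c * of_real (Im (fst x $ j)))"

definition hfield :: "('n::finite \<Rightarrow> real) \<Rightarrow> complex \<Rightarrow> 'n \<Rightarrow> ('n heis \<Rightarrow> complex) \<Rightarrow> 'n heis \<Rightarrow> complex" where
  "hfield l c j u x =
     (frechet_derivative u (at x) (axis j 1, 0) + c * frechet_derivative u (at x) (axis j \<i>, 0)) / 2
     + field_coeff l c j x * frechet_derivative u (at x) (0, 1)"

lemma bounded_linear_Re_nth: "bounded_linear (\<lambda>x::('n::finite) heis. complex_of_real (Re (fst x $ j)))"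
  by (intro bounded_linear_compose[OF bounded_linear_of_real] bounded_linear_compose[OF bounded_linear_Re]
      bounded_linear_compose[OF bounded_linear_vec_nth] bounded_linear_fst)

lemma bounded_linear_Im_nth: "bounded_linear (\<lambda>x::('n::finite) heis. complex_of_real (Im (fst x $ j)))"
  by (intro bounded_linear_compose[OF bounded_linear_of_real] bounded_linear_compose[OF bounded_linear_Im]
      bounded_linear_compose[OF bounded_linear_vec_nth] bounded_linear_fst)

lemma Ck_field_coeff: "Ck k (field_coeff l c j)"
  unfolding field_coeff_def[abs_def]
  by (intro Ck_mult Ck_add Ck_const Ck_bounded_linear[OF bounded_linear_Re_nth]
      Ck_bounded_linear[OF bounded_linear_Im_nth])

lemma frechet_derivative_field_coeff:
  "frechet_derivative (field_coeff l c j) (at x) v = field_coeff l c j v"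
proof (rule frechet_derivative_eqI)
  have "bounded_linear (field_coeff l c j)"
    unfolding field_coeff_def[abs_def]
    by (intro bounded_linear_const_mult bounded_linear_add bounded_linear_Re_nth bounded_linear_Im_nth)
  then show "(field_coeff l c j has_derivative field_coeff l c j) (at x)"
    by (rule bounded_linear_imp_has_derivative)
qed

lemma Ck_hfield: "Ck (Suc k) u \<Longrightarrow> Ck k (hfield l c j u)"
  unfolding hfield_def[abs_def] divide_inverse
  by (intro Ck_mult Ck_add Ck_const Ck_field_coeff Ck_frechet_derivative)

lemma Ck_differentiable: "Ck (Suc k) u \<Longrightarrow> u differentiable (at x)"
  by simp

lemma hfield_const [simp]: "hfield l c j (\<lambda>_. a) x = 0"
  by (simp add: hfield_def)

lemma hfield_add:
  assumes "u differentiable (at x)" "v differentiable (at x)"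
  shows "hfield l c j (\<lambda>x. u x + v x) x = hfield l c j u x + hfield l c j v x"
  using assms by (simp add: hfield_def frechet_derivative_add algebra_simps add_divide_distrib)

lemma hfield_mult:
  assumes "u differentiable (at x)" "v differentiable (at x)"
  shows "hfield l c j (\<lambda>x. u x * v x) x = u x * hfield l c j v x + hfield l c j u x * v x"
  using assms by (simp add: hfield_def frechet_derivative_mult algebra_simps add_divide_distrib)

lemma hfield_cmult:
  assumes "u differentiable (at x)"
  shows "hfield l c j (\<lambda>x. a * u x) x = a * hfield l c j u x"
  using hfield_mult[OF differentiable_const assms, of l c j a] by simp

lemma hfield_sum:
  assumes "\<And>i. i \<in> I \<Longrightarrow> u i differentiable (at x)"
  shows "hfield l c j (\<lambda>x. \<Sum>i\<in>I. u i x) x = (\<Sum>i\<in>I. hfield l c j (u i) x)"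
  using assms
proof (induction I rule: infinite_finite_induct)
  case (insert i I)
  then have "(\<lambda>x. \<Sum>i\<in>I. u i x) differentiable (at x)"
    by (intro differentiable_sum) auto
  then show ?case using insert by (simp add: hfield_add)
qed auto

lemma cnj_hfield:
  assumes "u differentiable (at x)"
  shows "cnj (hfield l c j u x) = hfield l (cnj c) j (\<lambda>x. cnj (u x)) x"
  using assms bounded_linear.frechet_derivative_linear[OF bounded_linear_cnj assms]
  by (simp add: hfield_def field_coeff_def)

text \<open>The product rule separates the second-order part from the only first-order term, in
  which the outer field hits the coefficient of the inner one. This happens just for i = j, because
  that coefficient is a function of z_i.\<close>

lemma hfield_hfield:
  assumes u: "Ck (Suc (Suc k)) u"
  shows "hfield l c j (hfield l d i u) x =
    (hfield l c j (\<lambda>y. frechet_derivative u (at y) (axis i 1, 0)) x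
      + d * hfield l c j (\<lambda>y. frechet_derivative u (at y) (axis i \<i>, 0)) x) / 2
    + field_coeff l d i x * hfield l c j (\<lambda>y. frechet_derivative u (at y) (0, 1)) x
    + (if i = j then of_real (l j) * d * (1 + c * d) / 2 else 0) * frechet_derivative u (at x) (0, 1)"
proof -
  have diff: "(\<lambda>y. frechet_derivative u (at y) v) differentiable (at x)" for v
    by (rule Ck_differentiable[OF Ck_frechet_derivative[OF u]])
  have diffc: "field_coeff l d i differentiable (at x)"
    by (rule Ck_differentiable[OF Ck_field_coeff])
  have "hfield l c j (field_coeff l d i) x = (if i = j then of_real (l j) * d * (1 + c * d) / 2 else 0)"
    by (simp add: hfield_def frechet_derivative_field_coeff) (simp add: field_coeff_def axis_def algebra_simps)
  moreover define a b :: complex where "a = 1 / 2" and "b = d / 2"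
  have "hfield l d i u = (\<lambda>y. (a * frechet_derivative u (at y) (axis i 1, 0)
      + b * frechet_derivative u (at y) (axis i \<i>, 0))
      + field_coeff l d i y * frechet_derivative u (at y) (0, 1))"
    by (auto simp: hfield_def fun_eq_iff a_def b_def algebra_simps add_divide_distrib)
  then have "hfield l c j (hfield l d i u) x =
      (a * hfield l c j (\<lambda>y. frechet_derivative u (at y) (axis i 1, 0)) x
      + b * hfield l c j (\<lambda>y. frechet_derivative u (at y) (axis i \<i>, 0)) x)
      + (field_coeff l d i x * hfield l c j (\<lambda>y. frechet_derivative u (at y) (0, 1)) x
      + hfield l c j (field_coeff l d i) x * frechet_derivative u (at x) (0, 1))"
    using diff diffc
    by (simp add: hfield_add hfield_cmult hfield_mult differentiable_mult differentiable_add)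
  ultimately show ?thesis
    by (simp add: a_def b_def algebra_simps add_divide_distrib)
qed

text \<open>Second-order parts cancel by symmetry of second derivatives, leaving the derivatives of
  the coefficients. For c = -\<i> and d = \<i> the factor is 2 \<i> \<lambda>_j.\<close>

lemma hfield_commute:
  assumes u: "Ck (Suc (Suc k)) u"
  shows "hfield l c j (hfield l d i u) x - hfield l d i (hfield l c j u) x =
    (if i = j then of_real (l j) * (d - c) * (1 + c * d) / 2 else 0) * frechet_derivative u (at x) (0, 1)"
proof -
  have e: "(if i = j then of_real (l j) * (d - c) * (1 + c * d) / 2 else 0) =
      (if i = j then of_real (l j) * d * (1 + c * d) / 2 else 0) -
      (if j = i then of_real (l i) * c * (1 + d * c) / 2 else (0::complex))"
    by (auto simp: algebra_simps diff_divide_distrib)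
  note comm = frechet_derivative_commute[OF u]
  show ?thesis
    unfolding hfield_hfield[OF u] e
    unfolding hfield_def
    unfolding comm[of "(axis i 1, 0)" x] comm[of "(axis i \<i>, 0)" x] comm[of "(0,1)" x "(axis j 1, 0)"]
      comm[of "(0,1)" x "(axis j \<i>, 0)"]
    by (simp add: algebra_simps add_divide_distrib diff_divide_distrib)
qed

text \<open>The fields are divergence-free: the coefficient of the t-derivative does not depend on
  t, so it can be drawn inside that derivative, and every summand becomes the derivative of a
  compactly supported function.\<close>

lemma integral_hfield_eq_0:
  assumes w: "Ck (Suc 0) w" and supp: "\<And>x. norm x > R \<Longrightarrow> w x = 0"
  shows "integrable lborel (hfield l c j w)" "(LINT x|lborel. hfield l c j w x) = 0"
proof -
  have cw: "Ck (Suc 0) (\<lambda>x. field_coeff l c j x * w x)"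
    by (intro Ck_mult Ck_field_coeff w)
  have int: "integrable lborel (\<lambda>x. frechet_derivative f (at x) v)"
    if "Ck (Suc 0) f" and f: "\<And>x. norm x > R \<Longrightarrow> f x = 0" for f :: "'a heis \<Rightarrow> complex" and v
    by (rule integrable_continuous_bounded_support[OF
          Ck_imp_continuous_on[OF Ck_frechet_derivative[OF that(1)]] frechet_derivative_outside_ball[OF f]])
  have eq: "hfield l c j w x = ((1/2) * frechet_derivative w (at x) (axis j 1, 0)
      + (c/2) * frechet_derivative w (at x) (axis j \<i>, 0))
      + frechet_derivative (\<lambda>x. field_coeff l c j x * w x) (at x) (0, 1)" for x
    using w frechet_derivative_mult[OF Ck_differentiable[OF Ck_field_coeff] Ck_differentiable[OF w], of l c j x "(0, 1)"]
    by (simp add: hfield_def frechet_derivative_field_coeff algebra_simps add_divide_distrib)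
      (simp add: field_coeff_def)
  show "integrable lborel (hfield l c j w)"
    unfolding eq[abs_def] using int[OF w supp] int[OF cw] supp by auto
  have "(LINT x|lborel. hfield l c j w x) = (1/2) * 0 + (c/2) * 0 + 0"
    unfolding eq using int[OF w supp] int[OF cw] supp
      integral_frechet_derivative_eq_0[OF w supp] integral_frechet_derivative_eq_0[OF cw, of R]
    by (simp add: Bochner_Integration.integral_add)
  then show "(LINT x|lborel. hfield l c j w x) = 0" by simp
qed


subsection \<open>The energy estimate\<close>

definition gauge :: "real \<Rightarrow> ('n::finite) heis \<Rightarrow> real" where
  "gauge R x = (fst x \<bullet> fst x) / R\<^sup>2 + (snd x)\<^sup>2 / R ^ 4"

text \<open>
  The gauge is homogeneous under \<open>(z, t) \<mapsto> (r z, r\<^sup>2 t)\<close>, so that \<open>Z\<^sub>j\<close> and \<open>Zbar\<^sub>j\<close>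
  of the cutoff are of size \<open>1 / R\<close>.
\<close>

definition cutoff :: "real \<Rightarrow> ('n::finite) heis \<Rightarrow> real" where
  "cutoff R x = (max 0 (1 - gauge R x))\<^sup>2"

lemma max_0_square_has_derivative:
  "((\<lambda>r. (max 0 r)\<^sup>2) has_real_derivative 2 * max 0 r) (at r)"
proof (cases r "0::real" rule: linorder_cases)
  case less
  have "((\<lambda>r. (max 0 r)\<^sup>2) has_real_derivative 0) (at r)"
    by (rule has_field_derivative_transform_within[where f = "\<lambda>_. 0" and d = "- r"])
      (use less in \<open>auto simp: dist_real_def\<close>)
  then show ?thesis using less by simp
next
  case equal
  have "((\<lambda>h::real. (max 0 (0 + h))\<^sup>2 / h) \<longlongrightarrow> 0) (at 0)"
  proof (rule Lim_null_comparison)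
    show "\<forall>\<^sub>F h::real in at 0. norm ((max 0 (0 + h))\<^sup>2 / h) \<le> norm h"
      by (auto simp: eventually_at_filter power2_eq_square max_def)
    show "((\<lambda>h::real. norm h) \<longlongrightarrow> 0) (at 0)"
      by (intro tendsto_norm_zero) (rule tendsto_ident_at)
  qed
  then show ?thesis using equal by (simp add: DERIV_def)
next
  case greater
  have "((\<lambda>r. r\<^sup>2) has_real_derivative 2 * max 0 r) (at r)"
    using greater by (auto intro!: derivative_eq_intros)
  then show ?thesis
    by (rule has_field_derivative_transform_within[where d = r])
      (use greater in \<open>auto simp: dist_real_def\<close>)
qed

lemma Ck_cutoff: "Ck (Suc 0) (cutoff R)"
proof -
  have m: "Ck (Suc 0) (\<lambda>r::real. (max 0 r)\<^sup>2)"
    by (rule Ck_SucI[OF max_0_square_has_derivative[unfolded has_field_derivative_def]])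
      (auto intro!: continuous_intros)
  have g: "Ck (Suc 0) (\<lambda>x. 1 - ((fst x \<bullet> fst x) * inverse (R\<^sup>2) + (snd x * snd x) * inverse (R ^ 4)))"
    by (intro Ck_diff Ck_add Ck_mult Ck_const bounded_bilinear.Ck_bilinear[OF bounded_bilinear_inner]
        Ck_bounded_linear bounded_linear_fst bounded_linear_snd)
  show ?thesis
    using Ck_compose[OF m g] by (simp add: cutoff_def[abs_def] gauge_def divide_inverse power2_eq_square)
qed

lemma cutoff_has_derivative:
  "(cutoff R has_derivative (\<lambda>v. - (2 * max 0 (1 - gauge R x)) *
     (2 * (fst x \<bullet> fst v) / R\<^sup>2 + 2 * snd x * snd v / R ^ 4))) (at x)"
proof -
  have "(gauge R has_derivative (\<lambda>v. 2 * (fst x \<bullet> fst v) / R\<^sup>2 + 2 * snd x * snd v / R ^ 4)) (at x)"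
    unfolding gauge_def[abs_def] divide_inverse
    by (auto intro!: derivative_eq_intros simp: fun_eq_iff inner_commute algebra_simps)
  then have "((\<lambda>x. 1 - gauge R x) has_derivative
      (\<lambda>v. 0 - (2 * (fst x \<bullet> fst v) / R\<^sup>2 + 2 * snd x * snd v / R ^ 4))) (at x)"
    by (intro derivative_intros)
  from has_derivative_compose[OF this max_0_square_has_derivative[unfolded has_field_derivative_def]]
  show ?thesis unfolding cutoff_def[abs_def] by (simp add: algebra_simps)
qed

lemma cutoff_nonneg: "0 \<le> cutoff R x"
  by (simp add: cutoff_def)

lemma gauge_lt_1:
  assumes "gauge R x < 1" "R > 0"
  shows "norm (fst x) < R" "\<bar>snd x\<bar> < R\<^sup>2"
proof -
  have "(norm (fst x))\<^sup>2 / R\<^sup>2 < 1" "(snd x)\<^sup>2 / R ^ 4 < 1"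
    using assms unfolding gauge_def power2_norm_eq_inner[symmetric]
    by (smt (verit, best) divide_nonneg_nonneg zero_le_power2 zero_le_power)+
  then have *: "(norm (fst x))\<^sup>2 < R\<^sup>2" "\<bar>snd x\<bar>\<^sup>2 < (R\<^sup>2)\<^sup>2"
    using assms(2) by (simp_all add: divide_less_eq)
  show "norm (fst x) < R" "\<bar>snd x\<bar> < R\<^sup>2"
    using power_less_imp_less_base[OF *(1)] power_less_imp_less_base[OF *(2)] assms(2) by auto
qed

lemma cutoff_eq_0:
  assumes "R > 0" "norm x > R + R\<^sup>2" shows "cutoff R x = 0"
proof -
  have "norm x \<le> norm (fst x) + \<bar>snd x\<bar>"
    using norm_Pair_le[of "fst x" "snd x"] by simp
  then have "gauge R x \<ge> 1"
    using gauge_lt_1[of R x] assms by (cases "gauge R x < 1") auto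
  then show ?thesis by (simp add: cutoff_def)
qed

lemma gauge_mono:
  assumes "0 < R" "R \<le> R'" shows "gauge R' x \<le> gauge R x"
  unfolding gauge_def using assms
  by (intro add_mono divide_left_mono power_mono mult_pos_pos) auto

lemma cutoff_mono:
  assumes "0 < R" "R \<le> R'" shows "cutoff R x \<le> cutoff R' x"
  unfolding cutoff_def using gauge_mono[OF assms, of x] by (intro power_mono) auto

lemma ex_cutoff_pos: "\<exists>R>0. cutoff R x > 0"
proof -
  define R where "R = 2 * (1 + norm x)"
  have R: "R \<ge> 1"
    by (simp add: R_def)
  then have R2: "R > 0" by simp
  have n: "norm (fst x) \<le> R / 2" "\<bar>snd x\<bar> \<le> R / 2"
    using norm_fst_le[of "fst x" "snd x"] norm_snd_le[of "snd x" "fst x"] by (auto simp: R_def)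
  have "(fst x \<bullet> fst x) \<le> (R / 2)\<^sup>2" "(snd x)\<^sup>2 \<le> (R / 2)\<^sup>2"
    using power_mono[OF n(1), of 2] power_mono[OF n(2), of 2] by (auto simp: power2_norm_eq_inner)
  moreover have "R\<^sup>2 \<le> R ^ 4" using R by (intro power_increasing) auto
  ultimately have "(fst x \<bullet> fst x) / R\<^sup>2 \<le> 1 / 4" "(snd x)\<^sup>2 / R ^ 4 \<le> 1 / 4"
    using R2 by (auto simp: power_divide field_simps)
  then have "cutoff R x > 0" by (simp add: cutoff_def gauge_def)
  then show ?thesis using R2 by blast
qed

text \<open>The cutoff is m^2 with m = max 0 (1 - gauge), so its derivative carries a factor m, the
  square root on the right; this root is what allows absorption in the energy estimate. On the
  support |z| < R and |t| < R^2, whence 4 m R (1 / (2 R^2) + |\<lambda>_j| / R^2) and the stated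
  constant. The conditions on c say c = \<i> or c = -\<i>.\<close>

lemma norm_hfield_cutoff:
  fixes x :: "('n::finite) heis"
  assumes R: "R > 0" and c: "norm c = 1" "cnj c = - c"
  shows "norm (hfield l c j (\<lambda>x. complex_of_real (cutoff R x)) x) \<le>
    (2 + 4 * \<bar>l j\<bar>) / R * sqrt (cutoff R x)"
proof -
  define m where "m = max 0 (1 - gauge R x)"
  define z where "z = fst x $ j"
  define t where "t = snd x"
  have c': "c = \<i> \<or> c = - \<i>"
  proof -
    have "Re c = 0" using c(2) by (simp add: complex_eq_iff)
    then have "\<bar>Im c\<bar> = 1" using c(1) by (simp add: cmod_def)
    then show ?thesis using \<open>Re c = 0\<close> by (auto simp: complex_eq_iff abs_if split: if_splits)
  qed
  have D: "frechet_derivative (\<lambda>x. complex_of_real (cutoff R x)) (at x) v = of_real (- (2 * m) *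
     (2 * (fst x \<bullet> fst v) / R\<^sup>2 + 2 * snd x * snd v / R ^ 4))" for v
    unfolding m_def
    by (rule frechet_derivative_eqI, rule bounded_linear.has_derivative[OF bounded_linear_of_real])
      (rule cutoff_has_derivative)
  have in1: "fst x \<bullet> axis j 1 = Re z" and in2: "fst x \<bullet> axis j \<i> = Im z"
    by (auto simp: z_def inner_axis inner_complex_def)
  define w where "w = of_real (Re z) + c * of_real (Im z)"
  have "hfield l c j (\<lambda>x. complex_of_real (cutoff R x)) x =
      of_real (- 4 * m) * w * (of_real (1 / (2 * R\<^sup>2)) + c * of_real (l j * t / R ^ 4))"
    unfolding hfield_def D field_coeff_def
    using R by (simp add: in1 in2 z_def[symmetric] t_def w_def field_simps)
  also have "norm \<dots> = 4 * m * norm w * norm (of_real (1 / (2 * R\<^sup>2)) + c * of_real (l j * t / R ^ 4))"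
    by (simp add: norm_mult m_def)
  also have "\<dots> \<le> (2 + 4 * \<bar>l j\<bar>) / R * m"
  proof (cases "gauge R x < 1")
    case True
    have "norm w = norm z"
      using c' by (auto simp: w_def cmod_def)
    also have "\<dots> \<le> norm (fst x)" unfolding z_def by (rule Finite_Cartesian_Product.norm_nth_le)
    finally have w: "norm w \<le> R" using gauge_lt_1[OF True R] by simp
    have "norm (of_real (1 / (2 * R\<^sup>2)) + c * of_real (l j * t / R ^ 4)) \<le>
        1 / (2 * R\<^sup>2) + \<bar>l j\<bar> * (\<bar>t\<bar> / R ^ 4)"
      by (rule norm_triangle_le) (simp add: norm_mult norm_divide norm_power c(1) abs_mult)
    also have "\<bar>t\<bar> / R ^ 4 \<le> R\<^sup>2 / R ^ 4"
      using gauge_lt_1(2)[OF True R] by (intro divide_right_mono) (auto simp: t_def)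
    also have "R\<^sup>2 / R ^ 4 = 1 / R\<^sup>2" using R by (simp add: field_simps eval_nat_numeral)
    finally have s: "norm (of_real (1 / (2 * R\<^sup>2)) + c * of_real (l j * t / R ^ 4)) \<le>
        1 / (2 * R\<^sup>2) + \<bar>l j\<bar> * (1 / R\<^sup>2)"
      by (simp add: mult_left_mono)
    have "norm w * norm (of_real (1 / (2 * R\<^sup>2)) + c * of_real (l j * t / R ^ 4)) \<le>
        R * (1 / (2 * R\<^sup>2) + \<bar>l j\<bar> * (1 / R\<^sup>2))"
      using w s R by (intro mult_mono) auto
    also have "\<dots> = (1 / 2 + \<bar>l j\<bar>) / R" using R by (simp add: field_simps power2_eq_square)
    finally have "(4 * m) * (norm w * norm (of_real (1 / (2 * R\<^sup>2)) + c * of_real (l j * t / R ^ 4))) \<le>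
        (4 * m) * ((1 / 2 + \<bar>l j\<bar>) / R)"
      by (intro mult_left_mono) (auto simp: m_def)
    also have "(4 * m) * ((1 / 2 + \<bar>l j\<bar>) / R) = (2 + 4 * \<bar>l j\<bar>) / R * m"
      by (simp add: algebra_simps add_divide_distrib)
    finally show ?thesis by (simp only: mult.assoc)
  qed (simp add: m_def)
  also have "m = sqrt (cutoff R x)" by (simp add: cutoff_def m_def)
  finally show ?thesis .
qed

text \<open>A Caccioppoli inequality. With X_p a field, X_p' its conjugate and k the cutoff, X_p' (k
  cnj(u) X_p u) integrates to 0. Expanding it and summing with weights, the second-order terms
  vanish by \<open>eq\<close>, and what remains bounds the integral of k times the energy density by
  B I / R^2, which tends to 0.\<close>

lemma energy_estimate:
  fixes u :: "('n::finite) heis \<Rightarrow> complex" and w :: "'n \<times> complex \<Rightarrow> real"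
  defines "P \<equiv> UNIV \<times> {\<i>, - \<i>}"
  assumes u: "Ck (Suc (Suc 0)) u" and sq: "integrable lborel (\<lambda>x. (norm (u x))\<^sup>2)"
    and w: "\<And>p. w p \<ge> 0"
    and eq: "\<And>x. (\<Sum>(j, c)\<in>P. of_real (w (j, c)) * hfield l (- c) j (hfield l c j u) x) = 0"
    and jc: "(j, c) \<in> P" "w (j, c) > 0"
  shows "hfield l c j u x = 0"
proof -
  define X where "X = (\<lambda>p. hfield l (snd p) (fst p) u)"
  define e where "e = (\<lambda>x. \<Sum>p\<in>P. w p * (norm (X p x))\<^sup>2)"
  define I where "I = (LINT x|lborel. (norm (u x))\<^sup>2)"
  define C where "C = (\<lambda>p :: 'n \<times> complex. 2 + 4 * \<bar>l (fst p)\<bar>)"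
  define B where "B = (\<Sum>p\<in>P. w p * (C p)\<^sup>2)"
  have u1: "Ck (Suc 0) u" by (rule Ck_Suc_imp_Ck[OF u])
  have cu: "Ck (Suc 0) (\<lambda>x. cnj (u x))" by (rule Ck_linear_compose[OF bounded_linear_cnj u1])
  have X: "Ck (Suc 0) (X p)" for p unfolding X_def by (rule Ck_hfield[OF u])
  have ce: "continuous_on UNIV e"
    unfolding e_def by (intro continuous_intros Ck_imp_continuous_on[OF X])
  have e0: "e x \<ge> 0" for x unfolding e_def using w by (intro sum_nonneg) auto
  have fin: "finite P" by (simp add: P_def)
  have bound: "(LINT x|lborel. cutoff R x * e x) \<le> B * I / R\<^sup>2" if R: "R > 0" for R
  proof -
    define k where "k = (\<lambda>x :: 'n heis. complex_of_real (cutoff R x))"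
    define F where "F = (\<lambda>p x. (k x * cnj (u x)) * X p x)"
    define G where "G = (\<lambda>x. \<Sum>p\<in>P. of_real (w p) * hfield l (- snd p) (fst p) (F p) x)"
    have k: "Ck (Suc 0) k" unfolding k_def by (rule Ck_linear_compose[OF bounded_linear_of_real Ck_cutoff])
    have F: "Ck (Suc 0) (F p)" for p unfolding F_def by (intro Ck_mult k cu X)
    have F0: "F p x = 0" if "norm x > R + R\<^sup>2" for p x
      using cutoff_eq_0[OF R that] by (simp add: F_def k_def)
    note iF = integral_hfield_eq_0[OF F F0]
    have G_int: "integrable lborel G"
      unfolding G_def by (intro Bochner_Integration.integrable_sum integrable_mult_right iF)
    have G0: "(LINT x|lborel. G x) = 0"
      unfolding G_def using iF by (subst Bochner_Integration.integral_sum) auto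
    have ptw: "Re (G x) \<ge> cutoff R x * e x / 2 - B / (2 * R\<^sup>2) * (norm (u x))\<^sup>2" for x
    proof -
      have diff: "k differentiable (at x)" "(\<lambda>x. cnj (u x)) differentiable (at x)"
        "(\<lambda>x. k x * cnj (u x)) differentiable (at x)" "X p differentiable (at x)" for p
        by (rule Ck_differentiable[OF k] Ck_differentiable[OF cu] Ck_differentiable[OF Ck_mult[OF k cu]]
            Ck_differentiable[OF X])+
      \<comment> \<open>For c = \<i> or -\<i>, -c is the conjugate of c, so the outer field applied
        to cnj(u) yields cnj(X_p u) and hence the square of |X_p u|.\<close>
      have term1: "hfield l (- snd p) (fst p) (F p) x =
          k x * cnj (u x) * hfield l (- snd p) (fst p) (X p) x
          + (of_real (cutoff R x * (norm (X p x))\<^sup>2)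
          + cnj (u x) * hfield l (- snd p) (fst p) k x * X p x)" if p: "p \<in> P" for p
      proof -
        have "hfield l (- snd p) (fst p) (\<lambda>x. cnj (u x)) x = cnj (X p x)"
          using p cnj_hfield[OF Ck_differentiable[OF u1], of l "snd p" "fst p" x]
          by (auto simp: X_def P_def)
        moreover have "X p x * cnj (X p x) = (of_real (norm (X p x)))\<^sup>2"
          by (metis complex_norm_square of_real_power)
        ultimately show ?thesis
          unfolding F_def hfield_mult[OF diff(3,4)] hfield_mult[OF diff(1,2)]
          by (simp add: algebra_simps k_def)
      qed
      have "(\<Sum>p\<in>P. of_real (w p) * (k x * cnj (u x) * hfield l (- snd p) (fst p) (X p) x)) =
          k x * cnj (u x) * (\<Sum>(j, c)\<in>P. of_real (w (j, c)) * hfield l (- c) j (hfield l c j u) x)"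
        unfolding sum_distrib_left by (intro sum.cong) (auto simp: X_def algebra_simps)
      then have Geq: "G x = (\<Sum>p\<in>P. of_real (w p) * (of_real (cutoff R x * (norm (X p x))\<^sup>2)
          + cnj (u x) * hfield l (- snd p) (fst p) k x * X p x))"
        unfolding G_def using eq by (simp add: term1 distrib_left sum.distrib)
      have young: "r * s \<le> (r\<^sup>2 + s\<^sup>2) / 2" for r s :: real
        using sum_squares_bound[of r s] by simp
      have low: "Re (of_real (cutoff R x * (norm (X p x))\<^sup>2) + cnj (u x) * hfield l (- snd p) (fst p) k x * X p x)
          \<ge> cutoff R x * (norm (X p x))\<^sup>2 / 2 - (C p)\<^sup>2 / (2 * R\<^sup>2) * (norm (u x))\<^sup>2" if p: "p \<in> P" for p
      proof -
        let ?y = "cnj (u x) * hfield l (- snd p) (fst p) k x * X p x"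
        have "norm (hfield l (- snd p) (fst p) k x) \<le> C p / R * sqrt (cutoff R x)"
          unfolding k_def C_def using p by (intro norm_hfield_cutoff[OF R]) (auto simp: P_def)
        then have "norm ?y \<le> norm (u x) * (C p / R * sqrt (cutoff R x)) * norm (X p x)"
          unfolding norm_mult complex_mod_cnj using R cutoff_nonneg[of R x]
          by (intro mult_right_mono mult_left_mono) auto
        \<comment> \<open>The root of the cutoff is grouped with X_p u: after Young's inequality
          half of the main term absorbs this part, and the other part is |u|^2 times a multiple of
          R^-2.\<close>
        also have "\<dots> = (C p / R * norm (u x)) * (sqrt (cutoff R x) * norm (X p x))" by simp
        also have "\<dots> \<le> ((C p / R * norm (u x))\<^sup>2 + (sqrt (cutoff R x) * norm (X p x))\<^sup>2) / 2"
          by (rule young)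
        also have "\<dots> = (C p)\<^sup>2 / (2 * R\<^sup>2) * (norm (u x))\<^sup>2 + cutoff R x * (norm (X p x))\<^sup>2 / 2"
          by (simp add: power_mult_distrib power_divide cutoff_nonneg add_divide_distrib)
        finally show ?thesis using abs_Re_le_cmod[of ?y] by auto
      qed
      have "cutoff R x * e x / 2 - B / (2 * R\<^sup>2) * (norm (u x))\<^sup>2 =
          (\<Sum>p\<in>P. w p * (cutoff R x * (norm (X p x))\<^sup>2 / 2 - (C p)\<^sup>2 / (2 * R\<^sup>2) * (norm (u x))\<^sup>2))"
        unfolding e_def B_def right_diff_distrib sum_subtractf sum_distrib_left sum_distrib_right sum_divide_distrib
        by (intro arg_cong2[where f = "(-)"] sum.cong) (auto simp: field_simps)
      also have "\<dots> \<le> (\<Sum>p\<in>P. w p * Re (of_real (cutoff R x * (norm (X p x))\<^sup>2)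
          + cnj (u x) * hfield l (- snd p) (fst p) k x * X p x))"
        using w low by (intro sum_mono mult_left_mono) auto
      also have "\<dots> = Re (G x)" unfolding Geq by simp
      finally show ?thesis .
    qed
    have cc: "continuous_on UNIV (\<lambda>x. cutoff R x * e x)"
      by (intro continuous_intros ce Ck_imp_continuous_on[OF Ck_cutoff])
    have int_ke: "integrable lborel (\<lambda>x. cutoff R x * e x)"
      by (rule integrable_continuous_bounded_support[OF cc]) (use cutoff_eq_0[OF R] in auto)
    have "(LINT x|lborel. cutoff R x * e x) \<le> (LINT x|lborel. 2 * Re (G x) + B / R\<^sup>2 * (norm (u x))\<^sup>2)"
    proof (rule integral_mono[OF int_ke])
      show "integrable lborel (\<lambda>x. 2 * Re (G x) + B / R\<^sup>2 * (norm (u x))\<^sup>2)"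
        using G_int sq by (intro Bochner_Integration.integrable_add integrable_mult_right integrable_Re)
      show "cutoff R x * e x \<le> 2 * Re (G x) + B / R\<^sup>2 * (norm (u x))\<^sup>2" for x
        using ptw[of x] by (simp add: field_simps)
    qed
    also have "\<dots> = 2 * Re (LINT x|lborel. G x) + B / R\<^sup>2 * I"
      using G_int sq by (simp add: I_def integrable_Re)
    finally show ?thesis by (simp add: G0)
  qed
  have "e x = 0"
  proof -
    \<comment> \<open>\<open>R0\<close> is fixed so that the cutoff is positive at the given point.
      Larger R only increase the cutoff, while the bound on the integral tends to 0.\<close>
    obtain R0 where R0: "R0 > 0" "cutoff R0 x > 0" using ex_cutoff_pos by blast
    have cc: "continuous_on UNIV (\<lambda>x. cutoff R x * e x)" for R
      by (intro continuous_intros ce Ck_imp_continuous_on[OF Ck_cutoff])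
    have int_ke: "integrable lborel (\<lambda>x. cutoff R x * e x)" if "R > 0" for R
      by (rule integrable_continuous_bounded_support[OF cc]) (use cutoff_eq_0[OF that] in auto)
    have le: "(LINT x|lborel. cutoff R0 x * e x) \<le> B * I / R\<^sup>2" if "R \<ge> R0" for R
    proof -
      have "(LINT x|lborel. cutoff R0 x * e x) \<le> (LINT x|lborel. cutoff R x * e x)"
        using that R0 e0 by (intro integral_mono int_ke mult_right_mono cutoff_mono) auto
      also have "\<dots> \<le> B * I / R\<^sup>2" using that R0 by (intro bound) auto
      finally show ?thesis .
    qed
    have "((\<lambda>R. B * I / R\<^sup>2) \<longlongrightarrow> 0) at_top"
      by (intro tendsto_divide_0[OF tendsto_const] filterlim_at_top_imp_at_infinity
          filterlim_pow_at_top filterlim_ident) auto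
    then have "(LINT x|lborel. cutoff R0 x * e x) \<le> 0"
      by (rule tendsto_lowerbound) (use le in \<open>auto intro: eventually_mono[OF eventually_ge_at_top[of R0]]\<close>)
    then have "cutoff R0 x * e x = 0"
      using int_ke[OF R0(1)] e0 cutoff_nonneg
      by (intro continuous_integral_eq_0[OF cc[of R0]] mult_nonneg_nonneg)
    then show ?thesis using R0 by simp
  qed
  then have "w (j, c) * (norm (X (j, c) x))\<^sup>2 = 0"
    unfolding e_def using fin w jc by (subst (asm) sum_nonneg_eq_0_iff) auto
  then show ?thesis using jc by (simp add: X_def)
qed


subsection \<open>Smoothing by group convolution\<close>

text \<open>The sum of 2 \<lambda>_j Im(cnj(w_j) z_j), a weighted symplectic form. The group law is
  (w, s)(z, t) = (w + z, s + t + twist l w z), with inverse (-z, -t).\<close>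

definition twist :: "('n::finite \<Rightarrow> real) \<Rightarrow> complex ^ 'n \<Rightarrow> complex ^ 'n \<Rightarrow> real" where
  "twist l w z = (\<Sum>j\<in>UNIV. 2 * l j * (Re (w $ j) * Im (z $ j) - Im (w $ j) * Re (z $ j)))"

text \<open>
  \<open>hquot l (x, y)\<close> is \<open>y x\<^sup>-\<^sup>1\<close> for the group law that makes the fields \<open>Z\<^sub>j\<close> invariant
  under left translations.
\<close>

definition hquot :: "('n::finite \<Rightarrow> real) \<Rightarrow> 'n heis \<times> 'n heis \<Rightarrow> 'n heis" where
  "hquot l p = (fst (snd p) - fst (fst p),
     snd (snd p) - snd (fst p) - twist l (fst (snd p)) (fst (fst p)))"

lemma bounded_bilinear_twist: "bounded_bilinear (twist l)"
  unfolding bilinear_conv_bounded_bilinear[symmetric] bilinear_def twist_def[abs_def]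
  by (intro conjI allI linearI)
    (simp_all add: algebra_simps sum.distrib sum_distrib_left sum_subtractf sum_negf)

lemma twist_axis:
  "twist l w (axis j 1) = - 2 * l j * Im (w $ j)" "twist l w (axis j \<i>) = 2 * l j * Re (w $ j)"
  "twist l (axis j 1) z = 2 * l j * Im (z $ j)" "twist l (axis j \<i>) z = - 2 * l j * Re (z $ j)"
  unfolding twist_def axis_def by (simp_all add: if_distrib if_distribR cong: if_cong)

lemma bounded_linear_heis_projections:
  "bounded_linear (\<lambda>p::'n::finite heis \<times> 'n heis. fst (fst p))"
  "bounded_linear (\<lambda>p::'n heis \<times> 'n heis. snd (fst p))"
  "bounded_linear (\<lambda>p::'n heis \<times> 'n heis. fst (snd p))"
  "bounded_linear (\<lambda>p::'n heis \<times> 'n heis. snd (snd p))"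
  by (intro bounded_linear_compose[OF bounded_linear_fst] bounded_linear_compose[OF bounded_linear_snd]
      bounded_linear_fst bounded_linear_snd)+

lemma Ck_hquot: "Ck k (hquot l)"
  unfolding hquot_def[abs_def]
  by (intro Ck_Pair Ck_diff bounded_bilinear.Ck_bilinear[OF bounded_bilinear_twist]
      bounded_linear_heis_projections[THEN Ck_bounded_linear])

lemma hquot_has_derivative_fst:
  "((\<lambda>x. hquot l (x, y)) has_derivative (\<lambda>v. (- fst v, - snd v - twist l (fst y) (fst v)))) (at x)"
  unfolding hquot_def
  by (auto intro!: derivative_eq_intros
      bounded_linear.has_derivative[OF bounded_bilinear.bounded_linear_right[OF bounded_bilinear_twist]])

lemma hquot_has_derivative_snd:
  "((\<lambda>y. hquot l (x, y)) has_derivative (\<lambda>v. (fst v, snd v - twist l (fst v) (fst x)))) (at y)"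
  unfolding hquot_def
  by (auto intro!: derivative_eq_intros
      bounded_linear.has_derivative[OF bounded_bilinear.bounded_linear_left[OF bounded_bilinear_twist]])

text \<open>Left-invariant fields generate right translations, and replacing x by xh in y x^-1 has
  the same effect as replacing y by y h^-1. The condition c * c = -1 makes
  \<open>hfield l c j\<close> the combination (X + cY)/2 of left-invariant real fields X and Y: only
  then does c^2 \<lambda>_j Im(z_j) equal the coefficient -\<lambda>_j Im(z_j) that X
  requires.\<close>

lemma hfield_hquot:
  fixes \<phi> :: "('n::finite) heis \<Rightarrow> complex"
  assumes \<phi>: "Ck (Suc k) \<phi>" and c: "c * c = - 1"
  shows "hfield l c j (\<lambda>x. \<phi> (hquot l (x, y))) x = - hfield l c j (\<lambda>y. \<phi> (hquot l (x, y))) y"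
proof -
  define L where "L = frechet_derivative \<phi> (at (hquot l (x, y)))"
  have \<phi>': "(\<phi> has_derivative L) (at (hquot l (x, y)))"
    unfolding L_def by (rule Ck_has_derivative[OF \<phi>])
  interpret L: bounded_linear L using has_derivative_bounded_linear[OF \<phi>'] .
  have split: "L (z, t) = L (z, 0) + t *\<^sub>R L (0, 1)" for z t
    using L.add[of "(z, 0)" "t *\<^sub>R (0, 1)"] L.scaleR[of t "(0, 1)"] by simp
  have neg: "L (- z, t) = - L (z, 0) + t *\<^sub>R L (0, 1)" for z t
    using L.neg[of "(z, 0)"] split[of "- z" t] by simp
  have Dx: "frechet_derivative (\<lambda>x. \<phi> (hquot l (x, y))) (at x) v =
      L (- fst v, - snd v - twist l (fst y) (fst v))" for v
    by (rule frechet_derivative_eqI[OF has_derivative_compose[OF hquot_has_derivative_fst \<phi>']])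
  have Dy: "frechet_derivative (\<lambda>y. \<phi> (hquot l (x, y))) (at y) v =
      L (fst v, snd v - twist l (fst v) (fst x))" for v
    by (rule frechet_derivative_eqI[OF has_derivative_compose[OF hquot_has_derivative_snd \<phi>']])
  have n1: "L (0, - 1) = - L (0, 1)"
    using L.neg[of "(0, 1)"] by simp
  have t0: "twist l w 0 = 0" "twist l 0 w = 0" for w
    by (simp_all add: twist_def)
  note sx = split[of "axis j 1" "0 - twist l (axis j 1) (fst x)"]
    split[of "axis j \<i>" "0 - twist l (axis j \<i>) (fst x)"]
  note sy = neg[of "axis j 1" "- 0 - twist l (fst y) (axis j 1)"]
    neg[of "axis j \<i>" "- 0 - twist l (fst y) (axis j \<i>)"] neg[of 0 "-1"]
  have cc: "c * (c * a) = - a" for a by (metis c mult.assoc mult_minus1)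
  show ?thesis
    unfolding hfield_def Dx Dy fst_conv snd_conv sx sy t0 field_coeff_def
    by (simp add: twist_axis scaleR_conv_of_real L.zero[unfolded zero_prod_def] algebra_simps
        add_divide_distrib diff_divide_distrib cc n1)
qed

lemma test_functions_bounded_support:
  assumes "\<phi> \<in> test_functions"
  obtains R where "\<And>x. norm x > R \<Longrightarrow> \<phi> x = 0"
proof -
  have "bounded (closure {x. \<phi> x \<noteq> 0})"
    using assms compact_imp_bounded by (auto simp: test_functions_def)
  then obtain R where "\<forall>x\<in>closure {x. \<phi> x \<noteq> 0}. norm x \<le> R" by (auto simp: bounded_iff)
  then have "\<phi> x = 0" if "norm x > R" for x
    using closure_subset[of "{x. \<phi> x \<noteq> 0}"] that by fastforce
  then show ?thesis using that by blast
qed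

lemma test_functionsI:
  assumes "\<And>k. Ck k \<phi>" and "\<And>x. norm x > R \<Longrightarrow> \<phi> x = 0"
  shows "\<phi> \<in> test_functions"
proof -
  have "norm x \<le> R" if "\<phi> x \<noteq> 0" for x using assms(2)[of x] that by linarith
  then have "{x. \<phi> x \<noteq> 0} \<subseteq> cball 0 R" by (auto simp: mem_cball_0)
  then have "bounded {x. \<phi> x \<noteq> 0}" using bounded_cball bounded_subset by blast
  then show ?thesis using assms(1) by (simp add: test_functions_def compact_closure)
qed

lemma test_functions_Ck: "\<phi> \<in> test_functions \<Longrightarrow> Ck k \<phi>"
  by (simp add: test_functions_def)

lemma proper_kernel_hquot:
  fixes \<phi> :: "('n::finite) heis \<Rightarrow> complex"
  assumes \<phi>: "\<And>x. norm x > R \<Longrightarrow> \<phi> x = 0"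
  shows "proper_kernel (\<lambda>p. \<phi> (hquot l p))"
  unfolding proper_kernel_def
proof
  fix r
  obtain B where B: "B \<ge> 0" "\<And>w z. \<bar>twist l w z\<bar> \<le> norm w * norm z * B"
    using bounded_bilinear.nonneg_bounded[OF bounded_bilinear_twist, of l] by auto
  \<comment> \<open>On the support of the kernel the z-part of y has norm at most R + r and its
    t-part is at most R + r + (R + r) r B, the last summand bounding the twist; the threshold adds
    the two.\<close>
  have "\<phi> (hquot l (x, y)) = 0" if x: "norm x \<le> r" and y: "norm y > 2 * R + 2 * r + (R + r) * r * B" for x y
  proof (rule \<phi>, rule ccontr)
    assume "\<not> R < norm (hquot l (x, y))"
    then have R: "norm (hquot l (x, y)) \<le> R" by simp
    have 1: "norm (fst y - fst x) \<le> R"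
      using R norm_fst_le[of "fst (hquot l (x, y))" "snd (hquot l (x, y))"] by (simp add: hquot_def)
    have 2: "\<bar>snd y - snd x - twist l (fst y) (fst x)\<bar> \<le> R"
      using R norm_snd_le[of "snd (hquot l (x, y))" "fst (hquot l (x, y))"] by (simp add: hquot_def)
    have x': "norm (fst x) \<le> r" "\<bar>snd x\<bar> \<le> r"
      using x norm_fst_le[of "fst x" "snd x"] norm_snd_le[of "snd x" "fst x"] by auto
    have y1: "norm (fst y) \<le> R + r"
      using 1 x'(1) norm_triangle_ineq2[of "fst y" "fst x"] by linarith
    have "norm (fst y) * norm (fst x) * B \<le> (R + r) * r * B"
      using y1 x' B(1) by (intro mult_mono mult_nonneg_nonneg) (auto intro: order_trans[OF norm_ge_zero])
    then have "\<bar>snd y\<bar> \<le> R + r + (R + r) * r * B"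
      using 2 x'(2) B(2)[of "fst y" "fst x"] by linarith
    then have "norm y \<le> 2 * R + 2 * r + (R + r) * r * B"
      using y1 norm_Pair_le[of "fst y" "snd y"] by simp
    then show False using y by simp
  qed
  then show "\<exists>R. \<forall>x y. norm x \<le> r \<longrightarrow> R < norm y \<longrightarrow> \<phi> (hquot l (x, y)) = 0"
    by blast
qed

lemma test_function_hquot:
  assumes \<phi>: "\<phi> \<in> test_functions"
  shows "(\<lambda>y. \<phi> (hquot l (x, y))) \<in> test_functions"
proof -
  obtain R where "\<And>x. norm x > R \<Longrightarrow> \<phi> x = 0"
    using test_functions_bounded_support[OF \<phi>] by blast
  then have "proper_kernel (\<lambda>p. \<phi> (hquot l p))" by (rule proper_kernel_hquot)
  then obtain R' where R': "\<And>x' y. norm x' \<le> norm x \<Longrightarrow> R' < norm y \<Longrightarrow> \<phi> (hquot l (x', y)) = 0"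
    by (rule proper_kernelE[where r = "norm x"]) blast
  show ?thesis
    using R' by (intro test_functionsI[where R = R'] Ck_compose[OF test_functions_Ck[OF \<phi>]]
        Ck_compose[OF Ck_hquot] Ck_Pair Ck_const Ck_bounded_linear bounded_linear_ident) auto
qed

lemma Ck_hquot_kernel: "\<phi> \<in> test_functions \<Longrightarrow> Ck k (\<lambda>p. \<phi> (hquot l p))"
  by (rule Ck_compose[OF test_functions_Ck Ck_hquot])

lemma proper_hquot_kernel: "\<phi> \<in> test_functions \<Longrightarrow> proper_kernel (\<lambda>p. \<phi> (hquot l p))"
  using test_functions_bounded_support proper_kernel_hquot by metis

text \<open>With y = wx this is the integral of \<phi>(w) s(wx) over w, an average of left
  translates of s.\<close>

definition smoothing ::
  "('n::finite \<Rightarrow> real) \<Rightarrow> ('n heis \<Rightarrow> complex) \<Rightarrow> ('n heis \<Rightarrow> complex) \<Rightarrow> 'n heis \<Rightarrow> complex" where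
  "smoothing l \<phi> s x = (LINT y|lborel. \<phi> (hquot l (x, y)) * s y)"

context
  fixes l :: "'n::finite \<Rightarrow> real" and \<phi> s :: "'n heis \<Rightarrow> complex"
  assumes \<phi>: "\<phi> \<in> test_functions" and s: "locally_integrable s"
begin

lemma Ck_smoothing: "Ck k (smoothing l \<phi> s)"
  unfolding smoothing_def[abs_def]
  by (rule Ck_kernel_integral[OF Ck_hquot_kernel[OF \<phi>] proper_hquot_kernel[OF \<phi>] s])

text \<open>Moving the field from x to y inside the kernel turns the right-hand side into a weak
  derivative of s, tested with the translated weight. Weak equations for s thereby become classical
  ones for its average.\<close>

lemma hfield_smoothing:
  assumes c: "c * c = - 1"
  shows "hfield l c j (smoothing l \<phi> s) x =
    - (LINT y|lborel. hfield l c j (\<lambda>y. \<phi> (hquot l (x, y))) y * s y)"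
proof -
  let ?K = "\<lambda>p. \<phi> (hquot l p)"
  let ?D = "\<lambda>v p. frechet_derivative ?K (at p) (v, 0)"
  note K = Ck_hquot_kernel[OF \<phi>, of "Suc 0" l]
  have D: "frechet_derivative (smoothing l \<phi> s) (at x) v = (LINT y|lborel. ?D v (x, y) * s y)" for v
    unfolding smoothing_def[abs_def]
    by (rule frechet_derivative_eqI[OF has_derivative_kernel_integral[OF K proper_hquot_kernel[OF \<phi>] s]])
  have int: "integrable lborel (\<lambda>y. ?D v (x, y) * s y)" for v
    by (rule integrable_kernel[OF Ck_imp_continuous_on[OF Ck_frechet_derivative[OF K]]
          proper_kernel_frechet_derivative[OF proper_hquot_kernel[OF \<phi>]] s])
  have slice: "frechet_derivative (\<lambda>x. \<phi> (hquot l (x, y))) (at x) v = ?D v (x, y)" for v y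
    by (rule frechet_derivative_eqI[OF has_derivative_slice[OF K]])
  have "- (LINT y|lborel. hfield l c j (\<lambda>y. \<phi> (hquot l (x, y))) y * s y) =
      (LINT y|lborel. hfield l c j (\<lambda>x. \<phi> (hquot l (x, y))) x * s y)"
    unfolding hfield_hquot[OF test_functions_Ck[OF \<phi>] c] by simp
  also have "\<dots> = (LINT y|lborel. (1/2) * (?D (axis j 1, 0) (x, y) * s y)
      + (c/2) * (?D (axis j \<i>, 0) (x, y) * s y)
      + field_coeff l c j x * (?D (0, 1) (x, y) * s y))"
    unfolding hfield_def slice
    by (intro Bochner_Integration.integral_cong) (auto simp: algebra_simps add_divide_distrib)
  also have "\<dots> = (1/2) * (LINT y|lborel. ?D (axis j 1, 0) (x, y) * s y)
      + (c/2) * (LINT y|lborel. ?D (axis j \<i>, 0) (x, y) * s y)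
      + field_coeff l c j x * (LINT y|lborel. ?D (0, 1) (x, y) * s y)"
    by (simp only: int Bochner_Integration.integral_add Bochner_Integration.integrable_add
        integrable_mult_right integral_mult_right_zero)
  also have "\<dots> = hfield l c j (smoothing l \<phi> s) x"
    unfolding hfield_def D by (simp add: algebra_simps add_divide_distrib)
  finally show ?thesis ..
qed

end

section \<open>Invariance of Lebesgue measure and square integrability of the averages\<close>

lemma nn_integral_lborel_affine:
  fixes f :: "'a::euclidean_space \<Rightarrow> ennreal"
  assumes [measurable]: "f \<in> borel_measurable borel" and \<sigma>: "\<bar>\<sigma>\<bar> = 1"
  shows "(\<integral>\<^sup>+x. f (a + \<sigma> *\<^sub>R x) \<partial>lborel) = (\<integral>\<^sup>+x. f x \<partial>lborel)"
proof -
  have "\<sigma> \<noteq> 0" using \<sigma> by auto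
  then have "(\<integral>\<^sup>+x. f x \<partial>lborel) = (\<integral>\<^sup>+x. f x \<partial>density (distr lborel borel (\<lambda>x. a + \<sigma> *\<^sub>R x)) (\<lambda>_. \<bar>\<sigma>\<bar> ^ DIM('a)))"
    using lborel_affine by metis
  also have "\<dots> = (\<integral>\<^sup>+x. f (a + \<sigma> *\<^sub>R x) \<partial>lborel)"
    by (simp add: \<sigma> nn_integral_density nn_integral_distr)
  finally show ?thesis ..
qed

text \<open>Unimodularity of the group in concrete form: y x^-1 depends on either variable through a
  translation or reflection of z and a z-dependent shift of t. The sign \<sigma> is -1 in the
  variable x and 1 in y.\<close>

lemma nn_integral_lborel_shear:
  fixes f :: "'a::euclidean_space \<times> real \<Rightarrow> ennreal"
  assumes f [measurable]: "f \<in> borel_measurable borel" and b [measurable]: "b \<in> borel_measurable borel"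
    and \<sigma>: "\<bar>\<sigma>\<bar> = 1"
  shows "(\<integral>\<^sup>+p. f (a + \<sigma> *\<^sub>R fst p, b (fst p) + \<sigma> * snd p) \<partial>lborel) = (\<integral>\<^sup>+p. f p \<partial>lborel)"
proof -
  have \<sigma>0: "\<sigma> \<noteq> 0" using \<sigma> by auto
  have fp [measurable]: "f \<in> borel_measurable (lborel \<Otimes>\<^sub>M lborel)" by (simp add: lborel_prod)
  have "(\<integral>\<^sup>+p. f (a + \<sigma> *\<^sub>R fst p, b (fst p) + \<sigma> * snd p) \<partial>lborel) =
      (\<integral>\<^sup>+p. f (a + \<sigma> *\<^sub>R fst p, b (fst p) + \<sigma> * snd p) \<partial>(lborel \<Otimes>\<^sub>M lborel))"
    by (simp add: lborel_prod)
  also have "\<dots> = (\<integral>\<^sup>+z. (\<integral>\<^sup>+t. f (a + \<sigma> *\<^sub>R z, b z + \<sigma> * t) \<partial>lborel) \<partial>lborel)"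
    by (subst lborel.nn_integral_fst[symmetric]) auto
  also have "\<dots> = (\<integral>\<^sup>+z. (\<integral>\<^sup>+t. f (a + \<sigma> *\<^sub>R z, t) \<partial>lborel) \<partial>lborel)"
  proof (rule nn_integral_cong)
    fix z
    show "(\<integral>\<^sup>+t. f (a + \<sigma> *\<^sub>R z, b z + \<sigma> * t) \<partial>lborel) = (\<integral>\<^sup>+t. f (a + \<sigma> *\<^sub>R z, t) \<partial>lborel)"
      using nn_integral_real_affine[OF _ \<sigma>0, of "\<lambda>t. f (a + \<sigma> *\<^sub>R z, t)" "b z"] \<sigma> by simp
  qed
  also have "\<dots> = (\<integral>\<^sup>+z. (\<integral>\<^sup>+t. f (z, t) \<partial>lborel) \<partial>lborel)"
    by (rule nn_integral_lborel_affine[OF _ \<sigma>]) measurable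
  also have "\<dots> = (\<integral>\<^sup>+p. f p \<partial>(lborel \<Otimes>\<^sub>M lborel))"
    by (rule lborel.nn_integral_fst) auto
  finally show ?thesis by (simp add: lborel_prod)
qed

lemma twist_measurable [measurable]:
  "(\<lambda>z. twist l w z) \<in> borel_measurable borel" "(\<lambda>w. twist l w z) \<in> borel_measurable borel"
  by (intro borel_measurable_continuous_onI linear_continuous_on
      bounded_bilinear.bounded_linear_right[OF bounded_bilinear_twist]
      bounded_bilinear.bounded_linear_left[OF bounded_bilinear_twist])+

lemma nn_integral_hquot_fst:
  fixes f :: "('n::finite) heis \<Rightarrow> ennreal"
  assumes "f \<in> borel_measurable borel"
  shows "(\<integral>\<^sup>+x. f (hquot l (x, y)) \<partial>lborel) = (\<integral>\<^sup>+x. f x \<partial>lborel)"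
  using nn_integral_lborel_shear[OF assms, of "\<lambda>z. snd y - twist l (fst y) z" "-1" "fst y"]
  by (simp add: hquot_def algebra_simps)

lemma nn_integral_hquot_snd:
  fixes f :: "('n::finite) heis \<Rightarrow> ennreal"
  assumes "f \<in> borel_measurable borel"
  shows "(\<integral>\<^sup>+y. f (hquot l (x, y)) \<partial>lborel) = (\<integral>\<^sup>+y. f y \<partial>lborel)"
  using nn_integral_lborel_shear[OF assms, of "\<lambda>z. - snd x - twist l z (fst x)" "1" "- fst x"]
  by (simp add: hquot_def algebra_simps)

lemma locally_integrable_square_integrable:
  assumes s [measurable]: "s \<in> borel_measurable borel"
    and sq: "integrable lborel (\<lambda>x. (norm (s x))\<^sup>2)"
  shows "locally_integrable s"
  unfolding locally_integrable_def
proof (intro conjI allI)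
  fix r
  show "integrable lborel (\<lambda>y. indicator (cball 0 r) y * norm (s y))"
  proof (rule Bochner_Integration.integrable_bound)
    show "integrable lborel (\<lambda>y. indicator (cball 0 r) y + (norm (s y))\<^sup>2)"
      by (intro Bochner_Integration.integrable_add sq integrable_real_indicator
          emeasure_lborel_cball_finite) simp
    show "AE y in lborel. norm (indicator (cball 0 r) y * norm (s y)) \<le>
        norm (indicator (cball 0 r) y + (norm (s y))\<^sup>2)"
    proof (rule AE_I2)
      fix y
      have "norm (s y) \<le> 1 + (norm (s y))\<^sup>2"
        using sum_squares_bound[of "norm (s y)" 1] by (smt (verit) norm_ge_zero one_power2)
      then show "norm (indicator (cball 0 r) y * norm (s y)) \<le>
          norm (indicator (cball 0 r) y + (norm (s y))\<^sup>2)"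
        by (auto split: split_indicator)
    qed
  qed (intro borel_measurable_times borel_measurable_indicator borel_measurable_norm, use s in auto)
qed (rule s)

text \<open>A form of Young's inequality. Cauchy-Schwarz on the ball supporting \<phi> bounds
  |S(x)|^2 by M^2 m times the integral of |s|^2 over the y with y x^-1 in the ball. Integrating in x
  and exchanging the integrals gives M^2 m^2 times the squared norm of s; invariance of the measure
  is used once in each variable.\<close>

lemma square_integrable_smoothing:
  fixes s :: "('n::finite) heis \<Rightarrow> complex"
  assumes \<phi>: "\<phi> \<in> test_functions"
    and s [measurable]: "s \<in> borel_measurable borel" and sq: "integrable lborel (\<lambda>x. (norm (s x))\<^sup>2)"
  shows "integrable lborel (\<lambda>x. (norm (smoothing l \<phi> s x))\<^sup>2)"
proof -
  have ls: "locally_integrable s" by (rule locally_integrable_square_integrable[OF s sq])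
  obtain R where R: "\<And>x. norm x > R \<Longrightarrow> \<phi> x = 0"
    using test_functions_bounded_support[OF \<phi>] by blast
  obtain M where M: "M \<ge> 0" "\<And>x. norm x \<le> R \<Longrightarrow> norm (\<phi> x) \<le> M"
    using continuous_on_bounded_cball[OF Ck_imp_continuous_on[OF test_functions_Ck[OF \<phi>, of 0]],
        where r = R] by blast
  define A where "A = (indicator (cball 0 R) :: 'n heis \<Rightarrow> ennreal)"
  define m where "m = emeasure lborel (cball 0 R :: 'n heis set)"
  have Am [measurable]: "A \<in> borel_measurable borel"
    unfolding A_def by (intro borel_measurable_indicator) simp
  have qm [measurable]: "hquot l \<in> borel_measurable borel"
    by (rule borel_measurable_continuous_onI[OF Ck_imp_continuous_on[OF Ck_hquot]])
  have qm2 [measurable]: "hquot l \<in> borel_measurable (lborel \<Otimes>\<^sub>M lborel)"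
    using qm by (simp add: borel_prod[symmetric] cong: measurable_cong_sets)
  have Aq [measurable]: "(\<lambda>y. A (hquot l (x, y))) \<in> borel_measurable borel" for x
    by (rule measurable_compose[OF _ Am])
      (intro borel_measurable_continuous_onI continuous_on_compose2[OF Ck_imp_continuous_on[OF Ck_hquot]]
        continuous_intros, auto)
  \<comment> \<open>Since the indicator equals its square, it can be written twice below: one copy
    is a Cauchy-Schwarz factor and the other stays with s.\<close>
  have A2: "A x ^ 2 = A x" for x by (auto simp: A_def split: split_indicator)
  have mA: "(\<integral>\<^sup>+x. A x \<partial>lborel) = m" by (simp add: A_def m_def)
  have m_fin: "m < \<infinity>" unfolding m_def by (rule emeasure_lborel_cball_finite)
  have pt: "ennreal ((norm (smoothing l \<phi> s x))\<^sup>2) \<le>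
      ennreal M ^ 2 * (m * (\<integral>\<^sup>+y. A (hquot l (x, y)) * ennreal ((norm (s y))\<^sup>2) \<partial>lborel))" for x
  proof -
    have int: "integrable lborel (\<lambda>y. \<phi> (hquot l (x, y)) * s y)"
      by (rule integrable_kernel[OF Ck_imp_continuous_on[OF Ck_hquot_kernel[OF \<phi>]] proper_hquot_kernel[OF \<phi>] ls])
    have "ennreal (norm (smoothing l \<phi> s x)) \<le> (\<integral>\<^sup>+y. norm (\<phi> (hquot l (x, y)) * s y) \<partial>lborel)"
      unfolding smoothing_def by (rule integral_norm_bound_ennreal[OF int])
    also have "\<dots> \<le> (\<integral>\<^sup>+y. ennreal M * (A (hquot l (x, y)) * (A (hquot l (x, y)) * ennreal (norm (s y)))) \<partial>lborel)"
    proof (rule nn_integral_mono)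
      fix y
      show "ennreal (norm (\<phi> (hquot l (x, y)) * s y)) \<le>
          ennreal M * (A (hquot l (x, y)) * (A (hquot l (x, y)) * ennreal (norm (s y))))"
      proof (cases "norm (hquot l (x, y)) \<le> R")
        case True
        then have "norm (\<phi> (hquot l (x, y)) * s y) \<le> M * norm (s y)"
          unfolding norm_mult by (intro mult_right_mono M) auto
        then show ?thesis
          using True M(1) by (simp add: A_def ennreal_mult[symmetric] ennreal_leI)
      qed (simp add: R)
    qed
    also have "\<dots> = ennreal M * (\<integral>\<^sup>+y. A (hquot l (x, y)) * (A (hquot l (x, y)) * ennreal (norm (s y))) \<partial>lborel)"
      by (rule nn_integral_cmult) measurable
    finally have "(ennreal (norm (smoothing l \<phi> s x)))\<^sup>2 \<le>
        (ennreal M * (\<integral>\<^sup>+y. A (hquot l (x, y)) * (A (hquot l (x, y)) * ennreal (norm (s y))) \<partial>lborel))\<^sup>2"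
      by (rule power_mono) simp
    also have "\<dots> = ennreal M ^ 2 * (\<integral>\<^sup>+y. A (hquot l (x, y)) * (A (hquot l (x, y)) * ennreal (norm (s y))) \<partial>lborel)\<^sup>2"
      by (rule power_mult_distrib)
    also have "\<dots> \<le> ennreal M ^ 2 * ((\<integral>\<^sup>+y. A (hquot l (x, y)) ^ 2 \<partial>lborel) *
        (\<integral>\<^sup>+y. (A (hquot l (x, y)) * ennreal (norm (s y))) ^ 2 \<partial>lborel))"
      by (intro mult_left_mono Cauchy_Schwarz_nn_integral) auto
    also have "(\<integral>\<^sup>+y. A (hquot l (x, y)) ^ 2 \<partial>lborel) = m"
      unfolding A2 using nn_integral_hquot_snd[OF Am] mA by simp
    also have "(\<integral>\<^sup>+y. (A (hquot l (x, y)) * ennreal (norm (s y))) ^ 2 \<partial>lborel) =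
        (\<integral>\<^sup>+y. A (hquot l (x, y)) * ennreal ((norm (s y))\<^sup>2) \<partial>lborel)"
      by (simp add: power_mult_distrib A2 ennreal_power)
    finally show ?thesis by (simp add: ennreal_power)
  qed
  have "(\<integral>\<^sup>+x. ennreal ((norm (smoothing l \<phi> s x))\<^sup>2) \<partial>lborel) \<le>
      (\<integral>\<^sup>+x. ennreal M ^ 2 * m * (\<integral>\<^sup>+y. A (hquot l (x, y)) * ennreal ((norm (s y))\<^sup>2) \<partial>lborel) \<partial>lborel)"
    by (intro nn_integral_mono) (use pt in \<open>simp add: mult.assoc\<close>)
  also have "\<dots> = ennreal M ^ 2 * m * (\<integral>\<^sup>+x. (\<integral>\<^sup>+y. A (hquot l (x, y)) * ennreal ((norm (s y))\<^sup>2) \<partial>lborel) \<partial>lborel)"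
    by (rule nn_integral_cmult) measurable
  also have "(\<integral>\<^sup>+x. (\<integral>\<^sup>+y. A (hquot l (x, y)) * ennreal ((norm (s y))\<^sup>2) \<partial>lborel) \<partial>lborel) =
      (\<integral>\<^sup>+y. (\<integral>\<^sup>+x. A (hquot l (x, y)) * ennreal ((norm (s y))\<^sup>2) \<partial>lborel) \<partial>lborel)"
    by (rule lborel_pair.Fubini'[symmetric]) measurable
  also have "\<dots> = (\<integral>\<^sup>+y. m * ennreal ((norm (s y))\<^sup>2) \<partial>lborel)"
  proof (rule nn_integral_cong)
    fix y
    have "(\<lambda>x. A (hquot l (x, y))) \<in> borel_measurable borel"
      by (rule measurable_compose[OF _ Am])
        (intro borel_measurable_continuous_onI continuous_on_compose2[OF Ck_imp_continuous_on[OF Ck_hquot]]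
          continuous_intros, auto)
    then show "(\<integral>\<^sup>+x. A (hquot l (x, y)) * ennreal ((norm (s y))\<^sup>2) \<partial>lborel) = m * ennreal ((norm (s y))\<^sup>2)"
      using nn_integral_hquot_fst[OF Am] mA by (simp add: nn_integral_multc)
  qed
  also have "\<dots> = m * (\<integral>\<^sup>+y. ennreal ((norm (s y))\<^sup>2) \<partial>lborel)"
    by (rule nn_integral_cmult) measurable
  finally have "(\<integral>\<^sup>+x. ennreal ((norm (smoothing l \<phi> s x))\<^sup>2) \<partial>lborel) \<le>
      ennreal M ^ 2 * m * (m * (\<integral>\<^sup>+y. ennreal ((norm (s y))\<^sup>2) \<partial>lborel))" .
  also have "\<dots> < \<infinity>"
    using m_fin sq M(1) by (auto simp: integrable_iff_bounded ennreal_mult_less_top ennreal_power)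
  finally have "(\<integral>\<^sup>+x. ennreal ((norm (smoothing l \<phi> s x))\<^sup>2) \<partial>lborel) < \<infinity>" .
  moreover have "(\<lambda>x. (norm (smoothing l \<phi> s x))\<^sup>2) \<in> borel_measurable borel"
    by (intro borel_measurable_continuous_onI continuous_intros
        Ck_imp_continuous_on[OF Ck_smoothing[OF \<phi> ls, of 0]])
  ultimately show ?thesis by (intro integrableI_bounded) auto
qed

lemma smoothing_0:
  "smoothing l \<phi> s 0 = (LINT y|lborel. \<phi> y * s y)"
  by (simp add: smoothing_def hquot_def zero_prod_def twist_def)

lemma smoothing_zero [simp]: "smoothing l \<phi> (\<lambda>_. 0) = (\<lambda>_. 0)"
  by (simp add: smoothing_def fun_eq_iff)


subsection \<open>The Kohn Laplacian acts diagonally\<close>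

definition ins_sign :: "'n::{finite,linorder} \<Rightarrow> 'n set \<Rightarrow> complex" where
  "ins_sign j J = (- 1) ^ card {k \<in> J. k < j}"

lemma dzbar_wedge_nth_left:
  "dzbar_wedge j J $ K = (if j \<in> K \<and> J = K - {j} then ins_sign j J else 0)"
  by (auto simp: dzbar_wedge_def ins_sign_def axis_def)

lemma dzbar_wedge_nth_right:
  "dzbar_wedge j J $ K = (if j \<notin> J \<and> K = insert j J then ins_sign j J else 0)"
  by (auto simp: dzbar_wedge_def ins_sign_def axis_def)

lemma ins_sign_square [simp]: "ins_sign j J * ins_sign j J = 1"
  by (simp add: ins_sign_def flip: power_add)

text \<open>The wedge with index j anticommutes with contraction by k \<noteq> j. Of the two indices
  the larger one has one more predecessor on the right-hand side than on the left, and the smaller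
  one is unaffected.\<close>

lemma ins_sign_anticommute:
  assumes k: "k \<in> L" and j: "j \<notin> L"
  shows "ins_sign k (L - {k}) * ins_sign j (L - {k}) =
    - (ins_sign j L * ins_sign k (insert j L - {k}))"
proof -
  have kj: "k \<noteq> j" using assms by auto
  have k1: "{i \<in> L - {k}. i < k} = {i \<in> L. i < k}" by auto
  show ?thesis
  proof (cases "k < j")
    case True
    have 1: "{i \<in> L. i < j} = insert k {i \<in> L - {k}. i < j}" using True k by auto
    have 2: "{i \<in> insert j L - {k}. i < k} = {i \<in> L. i < k}" using True by auto
    show ?thesis unfolding ins_sign_def 2 k1 1 by simp
  next
    case False
    then have jk: "j < k" using kj by auto
    have 1: "{i \<in> L - {k}. i < j} = {i \<in> L. i < j}" using jk by auto
    have 2: "{i \<in> insert j L - {k}. i < k} = insert j {i \<in> L. i < k}" using jk by auto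
    show ?thesis unfolding ins_sign_def 2 k1 1 using j by simp
  qed
qed

text \<open>The hypotheses say that S is annihilated by dbar and, up to sign, by its adjoint. For k
  in L, Zbar_k is applied to the adjoint equation at L - {k}; for j outside L, Z_j is applied to the
  dbar equation at L with j added. Each result is a diagonal term plus mixed terms with j \<noteq>
  k. Mixed fields commute, so by anticommutation of the signs the mixed terms \<open>?C k j\<close>
  occur once with each sign.\<close>

lemma kohn_laplacian_diagonal:
  fixes S :: "'n::{finite,linorder} set \<Rightarrow> 'n heis \<Rightarrow> complex"
  assumes S: "\<And>J. Ck (Suc (Suc 0)) (S J)"
    and dbar: "\<And>K x. (\<Sum>J\<in>UNIV. \<Sum>j\<in>UNIV. hfield l \<i> j (S J) x * dzbar_wedge j J $ K) = 0"
    and dbar_adj: "\<And>K x. (\<Sum>J\<in>UNIV. \<Sum>j\<in>UNIV. hfield l (- \<i>) j (S J) x * dzbar_wedge j K $ J) = 0"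
  shows "(\<Sum>j\<in>UNIV. if j \<in> L then hfield l \<i> j (hfield l (- \<i>) j (S L)) x
    else hfield l (- \<i>) j (hfield l \<i> j (S L)) x) = 0"
proof -
  have diff: "hfield l c j (S J) differentiable (at x)" for c j J x
    by (rule Ck_differentiable[OF Ck_hfield[OF S]])
  have d1: "(\<Sum>j\<in>K. ins_sign j (K - {j}) * hfield l \<i> j (S (K - {j})) x) = 0" for K x
  proof -
    have "(\<Sum>j\<in>K. ins_sign j (K - {j}) * hfield l \<i> j (S (K - {j})) x) =
        (\<Sum>j\<in>UNIV. \<Sum>J\<in>UNIV. hfield l \<i> j (S J) x * dzbar_wedge j J $ K)"
      unfolding dzbar_wedge_nth_left
      by (rule sum.mono_neutral_cong_left) (auto simp: if_distrib cong: if_cong)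
    also have "\<dots> = 0" by (subst sum.swap) (rule dbar)
    finally show ?thesis .
  qed
  have d2: "(\<Sum>j\<in>- K. ins_sign j K * hfield l (- \<i>) j (S (insert j K)) x) = 0" for K x
  proof -
    have "(\<Sum>j\<in>- K. ins_sign j K * hfield l (- \<i>) j (S (insert j K)) x) =
        (\<Sum>j\<in>UNIV. \<Sum>J\<in>UNIV. hfield l (- \<i>) j (S J) x * dzbar_wedge j K $ J)"
      unfolding dzbar_wedge_nth_right
      by (rule sum.mono_neutral_cong_left) (auto simp: if_distrib cong: if_cong)
    also have "\<dots> = 0" by (subst sum.swap) (rule dbar_adj)
    finally show ?thesis .
  qed
  have A: "(\<Sum>j\<in>- (L - {k}). ins_sign j (L - {k}) * hfield l \<i> k (hfield l (- \<i>) j (S (insert j (L - {k})))) x) = 0"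
    for k
  proof -
    have "(\<lambda>x. \<Sum>j\<in>- (L - {k}). ins_sign j (L - {k}) * hfield l (- \<i>) j (S (insert j (L - {k}))) x) = (\<lambda>_. 0)"
      using d2[of "L - {k}"] by (simp only:)
    then have "hfield l \<i> k (\<lambda>x. \<Sum>j\<in>- (L - {k}). ins_sign j (L - {k}) * hfield l (- \<i>) j (S (insert j (L - {k}))) x) x = 0"
      by simp
    then show ?thesis
      by (simp add: hfield_sum hfield_cmult diff differentiable_mult)
  qed
  have B: "(\<Sum>k\<in>insert j L. ins_sign k (insert j L - {k}) *
      hfield l (- \<i>) j (hfield l \<i> k (S (insert j L - {k}))) x) = 0" for j
  proof -
    have "(\<lambda>x. \<Sum>k\<in>insert j L. ins_sign k (insert j L - {k}) * hfield l \<i> k (S (insert j L - {k})) x) = (\<lambda>_. 0)"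
      using d1[of "insert j L"] by (simp only:)
    then have "hfield l (- \<i>) j (\<lambda>x. \<Sum>k\<in>insert j L. ins_sign k (insert j L - {k}) * hfield l \<i> k (S (insert j L - {k})) x) x = 0"
      by simp
    then show ?thesis
      by (subst (asm) hfield_sum) (auto simp: hfield_cmult diff differentiable_mult)
  qed
  let ?C = "\<lambda>k j. ins_sign k (L - {k}) * ins_sign j (L - {k}) *
      hfield l \<i> k (hfield l (- \<i>) j (S (insert j (L - {k})))) x"
  have A': "hfield l \<i> k (hfield l (- \<i>) k (S L)) x = - (\<Sum>j\<in>- L. ?C k j)" if k: "k \<in> L" for k
  proof -
    \<comment> \<open>The summand j = k is the diagonal one. Multiplying by its sign once more
      removes that sign, as its square is 1.\<close>
    have set: "- (L - {k}) = insert k (- L)" using k by auto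
    have "ins_sign k (L - {k}) * (ins_sign k (L - {k}) * hfield l \<i> k (hfield l (- \<i>) k (S L)) x
        + (\<Sum>j\<in>- L. ins_sign j (L - {k}) * hfield l \<i> k (hfield l (- \<i>) j (S (insert j (L - {k})))) x)) = 0"
      using A[of k] k unfolding set by (simp add: insert_absorb)
    then show ?thesis
      by (simp add: distrib_left mult.assoc[symmetric] sum_distrib_left eq_neg_iff_add_eq_0)
  qed
  have B': "hfield l (- \<i>) j (hfield l \<i> j (S L)) x = (\<Sum>k\<in>L. ?C k j)" if j: "j \<notin> L" for j
  proof -
    have "ins_sign j L * (ins_sign j L * hfield l (- \<i>) j (hfield l \<i> j (S L)) x
        + (\<Sum>k\<in>L. ins_sign k (insert j L - {k}) * hfield l (- \<i>) j (hfield l \<i> k (S (insert j L - {k}))) x)) = 0"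
      using B[of j] j by simp
    moreover have "ins_sign j L * (\<Sum>k\<in>L. ins_sign k (insert j L - {k}) *
        hfield l (- \<i>) j (hfield l \<i> k (S (insert j L - {k}))) x) = - (\<Sum>k\<in>L. ?C k j)"
      unfolding sum_distrib_left sum_negf[symmetric]
    proof (rule sum.cong)
      fix k assume k: "k \<in> L"
      then have kj: "k \<noteq> j" using j by auto
      have "hfield l (- \<i>) j (hfield l \<i> k (S (insert j L - {k}))) x =
          hfield l \<i> k (hfield l (- \<i>) j (S (insert j L - {k}))) x"
        using hfield_commute[OF S, of l "- \<i>" j \<i> k "insert j L - {k}" x] kj by simp
      moreover have "insert j L - {k} = insert j (L - {k})" using kj by auto
      ultimately show "ins_sign j L * (ins_sign k (insert j L - {k}) *
          hfield l (- \<i>) j (hfield l \<i> k (S (insert j L - {k}))) x) = - ?C k j"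
        using ins_sign_anticommute[OF k j] by (simp add: mult.assoc[symmetric])
    qed simp
    ultimately show ?thesis
      by (simp add: distrib_left mult.assoc[symmetric])
  qed
  have "(\<Sum>j\<in>UNIV. if j \<in> L then hfield l \<i> j (hfield l (- \<i>) j (S L)) x
      else hfield l (- \<i>) j (hfield l \<i> j (S L)) x) =
    (\<Sum>k\<in>L. hfield l \<i> k (hfield l (- \<i>) k (S L)) x) + (\<Sum>j\<in>- L. hfield l (- \<i>) j (hfield l \<i> j (S L)) x)"
    by (subst sum.If_cases) auto
  also have "\<dots> = - (\<Sum>k\<in>L. \<Sum>j\<in>- L. ?C k j) + (\<Sum>j\<in>- L. \<Sum>k\<in>L. ?C k j)"
    using A' B' by (simp add: sum_negf)
  also have "\<dots> = 0"
    by (subst sum.swap) simp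
  finally show ?thesis .
qed


subsection \<open>Vanishing of a single component\<close>

text \<open>
  On the component \<open>L\<close>, the fields entering \<open>box\<^sub>b\<close> have commutators proportional to
  \<open>comm_sign l L j\<close>. A convex combination of both orderings with vanishing total commutator
  turns \<open>box\<^sub>b\<close> into a sum of squares that contains \<open>Z\<^sub>j\<close> and \<open>Zbar\<^sub>j\<close> for the same \<open>j\<close>.
\<close>

definition comm_sign :: "('n \<Rightarrow> real) \<Rightarrow> 'n set \<Rightarrow> 'n \<Rightarrow> real" where
  "comm_sign l L j = (if j \<in> L then - l j else l j)"

text \<open>If no \<lambda>_j vanishes and all commutator signs agree, then L is the set of negative
  or the set of positive indices, which its cardinality rules out. The strict bound
  \<open>\<theta> i < 1\<close> matters: with \<open>\<theta> j > 0\<close> it gives both orderings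
  at j a positive weight.\<close>

lemma ex_balancing_weights:
  fixes l :: "'n::finite \<Rightarrow> real"
  assumes "(\<exists>j. l j = 0) \<or> card L \<notin> {card {j. l j < 0}, card {j. l j > 0}}"
  obtains \<theta> j where "\<And>i. 0 \<le> \<theta> i" "\<And>i. \<theta> i < 1" "(\<Sum>i\<in>UNIV. \<theta> i * comm_sign l L i) = 0" "\<theta> j > (0::real)"
proof (cases "\<exists>j. l j = 0")
  case True
  then obtain j where "l j = 0" by blast
  then have "(\<Sum>i\<in>UNIV. (if i = j then 1/2 else 0) * comm_sign l L i) = 0"
    by (intro sum.neutral) (auto simp: comm_sign_def)
  then show ?thesis by (intro that[of "\<lambda>i. if i = j then 1/2 else 0" j]) auto
next
  case False
  let ?\<sigma> = "comm_sign l L"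
  have nz: "?\<sigma> j \<noteq> 0" for j using False by (auto simp: comm_sign_def)
  have "\<not> (\<forall>j. ?\<sigma> j > 0)"
  proof
    assume *: "\<forall>j. ?\<sigma> j > 0"
    have "j \<in> L \<longleftrightarrow> l j < 0" for j
      using *[rule_format, of j] by (auto simp: comm_sign_def split: if_splits)
    then have "L = {j. l j < 0}" by blast
    then show False using assms False by auto
  qed
  then obtain n where n: "?\<sigma> n < 0" using nz by (meson linorder_neqE_linordered_idom)
  have "\<not> (\<forall>j. ?\<sigma> j < 0)"
  proof
    assume *: "\<forall>j. ?\<sigma> j < 0"
    have "j \<in> L \<longleftrightarrow> l j > 0" for j
      using *[rule_format, of j] by (auto simp: comm_sign_def split: if_splits)
    then have "L = {j. l j > 0}" by blast
    then show False using assms False by auto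
  qed
  then obtain p where p: "?\<sigma> p > 0" using nz by (meson linorder_neqE_linordered_idom)
  have pn: "p \<noteq> n" using p n by auto
  \<comment> \<open>The convex weights that place 0 between the negative value
    \<open>?\<sigma> n\<close> and the positive value \<open>?\<sigma> p\<close>.\<close>
  define \<theta> where "\<theta> = (\<lambda>i. if i = p then - ?\<sigma> n / (?\<sigma> p - ?\<sigma> n)
      else if i = n then ?\<sigma> p / (?\<sigma> p - ?\<sigma> n) else 0)"
  have "(\<Sum>i\<in>UNIV. \<theta> i * ?\<sigma> i) = (\<Sum>i\<in>{p, n}. \<theta> i * ?\<sigma> i)"
    by (rule sum.mono_neutral_right) (auto simp: \<theta>_def)
  also have "\<dots> = 0" using pn by (simp add: \<theta>_def field_simps)
  finally show ?thesis
    using p n by (intro that[of \<theta> p]) (auto simp: \<theta>_def field_simps)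
qed

lemma component_eq_0:
  fixes u :: "('n::finite) heis \<Rightarrow> complex"
  assumes l: "(\<exists>j. l j = 0) \<or> card L \<notin> {card {j. l j < 0}, card {j. l j > 0}}"
    and u: "Ck (Suc (Suc 0)) u" and sq: "integrable lborel (\<lambda>x. (norm (u x))\<^sup>2)"
    and eq: "\<And>x. (\<Sum>j\<in>UNIV. if j \<in> L then hfield l \<i> j (hfield l (- \<i>) j u) x
      else hfield l (- \<i>) j (hfield l \<i> j u) x) = 0"
  shows "u x = 0"
proof -
  obtain \<theta> j where \<theta>: "\<And>i. 0 \<le> \<theta> i" "\<And>i. \<theta> i < 1" "\<theta> j > 0"
    and bal: "(\<Sum>i\<in>UNIV. \<theta> i * comm_sign l L i) = 0"
    using ex_balancing_weights[OF l] by metis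
  \<comment> \<open>A pair (j, c) stands for the term whose inner field has parameter c. The
    ordering already present at j, with inner field Z_j exactly for j in L, keeps 1 - \<theta>_j,
    and the swapped one receives \<theta>_j.\<close>
  define w where "w = (\<lambda>p :: 'n \<times> complex.
      if (fst p \<in> L) = (snd p = - \<i>) then 1 - \<theta> (fst p) else \<theta> (fst p))"
  have i: "- \<i> \<noteq> \<i>" by (simp add: complex_eq_iff)
  have comm: "hfield l (- \<i>) j (hfield l \<i> j u) x - hfield l \<i> j (hfield l (- \<i>) j u) x =
      2 * \<i> * of_real (l j) * frechet_derivative u (at x) (0, 1)" for j x
    using hfield_commute[OF u, of l "- \<i>" j \<i> j x] by (simp add: algebra_simps)
  have w_eq: "(\<Sum>(j, c)\<in>UNIV \<times> {\<i>, - \<i>}. of_real (w (j, c)) * hfield l (- c) j (hfield l c j u) x) = 0"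
    for x
  proof -
    define D where "D = frechet_derivative u (at x) (0, 1)"
    have "(\<Sum>(j, c)\<in>UNIV \<times> {\<i>, - \<i>}. of_real (w (j, c)) * hfield l (- c) j (hfield l c j u) x) =
        (\<Sum>j\<in>UNIV. of_real (w (j, \<i>)) * hfield l (- \<i>) j (hfield l \<i> j u) x
          + of_real (w (j, - \<i>)) * hfield l \<i> j (hfield l (- \<i>) j u) x)"
      using i by (subst sum.cartesian_product[symmetric]) simp
    also have "\<dots> = (\<Sum>j\<in>UNIV. (if j \<in> L then hfield l \<i> j (hfield l (- \<i>) j u) x
        else hfield l (- \<i>) j (hfield l \<i> j u) x) - 2 * \<i> * D * of_real (\<theta> j * comm_sign l L j))"
    proof (rule sum.cong)
      fix j
      have Z: "hfield l (- \<i>) j (hfield l \<i> j u) x =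
          hfield l \<i> j (hfield l (- \<i>) j u) x + 2 * \<i> * of_real (l j) * D"
        using comm[of j x] by (simp add: D_def algebra_simps)
      show "of_real (w (j, \<i>)) * hfield l (- \<i>) j (hfield l \<i> j u) x
          + of_real (w (j, - \<i>)) * hfield l \<i> j (hfield l (- \<i>) j u) x =
        (if j \<in> L then hfield l \<i> j (hfield l (- \<i>) j u) x
        else hfield l (- \<i>) j (hfield l \<i> j u) x) - 2 * \<i> * D * of_real (\<theta> j * comm_sign l L j)"
        unfolding Z using i by (simp add: w_def comm_sign_def algebra_simps)
    qed simp
    also have "\<dots> = 0 - 2 * \<i> * D * of_real (\<Sum>j\<in>UNIV. \<theta> j * comm_sign l L j)"
      unfolding sum_subtractf eq by (simp add: sum_distrib_left)
    finally show ?thesis by (simp add: bal)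
  qed
  have w0: "w p \<ge> 0" for p using \<theta>(1,2)[of "fst p"] by (simp add: w_def less_imp_le)
  have wj: "w (j, c) > 0" for c using \<theta>(2)[of j] \<theta>(3) by (simp add: w_def)
  have van: "hfield l c j u x = 0" if "c \<in> {\<i>, - \<i>}" for c x
    using that by (intro energy_estimate[OF u sq w0 w_eq] wj) auto
  show ?thesis
  proof (cases "l j = 0")
    case True
    have "hfield l \<i> j u x + hfield l (- \<i>) j u x = 0" for x
      by (simp add: van)
    then have "frechet_derivative u (at x) (axis j 1, 0) = 0" for x
      unfolding hfield_def field_coeff_def by (simp add: True flip: add_divide_distrib)
    moreover have "(axis j 1 :: complex ^ 'n, 0 :: real) \<noteq> 0"
      by (simp add: zero_prod_def axis_eq_0_iff)
    ultimately show ?thesis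
      using square_integrable_translation_invariant_eq_0[OF Ck_Suc_imp_Ck[OF u] sq] by blast
  next
    case False
    have "hfield l \<i> j u = (\<lambda>_. 0)" "hfield l (- \<i>) j u = (\<lambda>_. 0)"
      using van by auto
    then have "frechet_derivative u (at x) (0, 1) = 0" for x
      using comm[of j x] False by simp
    moreover have "(0 :: complex ^ 'n, 1 :: real) \<noteq> 0"
      by (simp add: zero_prod_def)
    ultimately show ?thesis
      using square_integrable_translation_invariant_eq_0[OF Ck_Suc_imp_Ck[OF u] sq] by blast
  qed
qed


subsection \<open>Harmonic forms are weak solutions of a first-order system\<close>

lemma sets_heis_volume [simp, measurable_cong]: "sets heis_volume = sets borel"
  by (simp add: heis_volume_def)

lemma AE_heis_volume: "(AE x in heis_volume. P x) \<longleftrightarrow> (AE x in lborel. P x)"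
  unfolding heis_volume_def by (subst AE_density) auto

lemma
  fixes f :: "('n::finite) heis \<Rightarrow> 'b::{banach, second_countable_topology}"
  assumes f: "f \<in> borel_measurable borel"
  shows integrable_heis_volume: "integrable heis_volume f \<longleftrightarrow> integrable lborel f"
    and integral_heis_volume: "(LINT x|heis_volume. f x) = 2 ^ CARD('n) *\<^sub>R (LINT x|lborel. f x)"
proof -
  have d: "heis_volume = density lborel (\<lambda>_::'n heis. ennreal (2 ^ CARD('n)))"
    by (simp add: heis_volume_def)
  show "integrable heis_volume f \<longleftrightarrow> integrable lborel f"
  proof -
    have "integrable heis_volume f \<longleftrightarrow> integrable lborel (\<lambda>x. (2 ^ CARD('n) :: real) *\<^sub>R f x)"
      unfolding d using f by (subst integrable_density) auto
    also have "\<dots> \<longleftrightarrow> integrable lborel f"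
    proof
      assume "integrable lborel (\<lambda>x. (2 ^ CARD('n) :: real) *\<^sub>R f x)"
      then have "integrable lborel (\<lambda>x. inverse (2 ^ CARD('n) :: real) *\<^sub>R (2 ^ CARD('n) :: real) *\<^sub>R f x)"
        by (rule integrable_scaleR_right)
      then show "integrable lborel f" by simp
    qed simp
    finally show ?thesis .
  qed
  show "(LINT x|heis_volume. f x) = 2 ^ CARD('n) *\<^sub>R (LINT x|lborel. f x)"
    unfolding d using f by (subst integral_density) auto
qed

lemma square_norm_eq_sum: "(norm (v :: complex ^ 'm::finite))\<^sup>2 = (\<Sum>J\<in>UNIV. (norm (v $ J))\<^sup>2)"
  by (simp add: norm_vec_def L2_set_def sum_nonneg)

lemma L2_component:
  assumes "u \<in> L2 r"
  shows "(\<lambda>x. u x $ J) \<in> borel_measurable borel" "integrable lborel (\<lambda>x. (norm (u x $ J))\<^sup>2)"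
proof -
  have u: "u \<in> borel_measurable borel"
    using assms by (auto simp: L2_def cong: measurable_cong_sets)
  then show m: "(\<lambda>x. u x $ J) \<in> borel_measurable borel"
    by (rule measurable_compose) (intro borel_measurable_continuous_onI continuous_intros)
  have "integrable heis_volume (\<lambda>x. (norm (u x))\<^sup>2)"
    using assms by (simp add: L2_def)
  then have "integrable lborel (\<lambda>x. (norm (u x))\<^sup>2)"
    using u by (subst (asm) integrable_heis_volume) auto
  then show "integrable lborel (\<lambda>x. (norm (u x $ J))\<^sup>2)"
    by (rule Bochner_Integration.integrable_bound)
      (use m Finite_Cartesian_Product.norm_nth_le in \<open>auto intro!: power_mono\<close>)
qed

lemma L2_component_locally_integrable:
  "u \<in> L2 r \<Longrightarrow> locally_integrable (\<lambda>x. u x $ J)"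
  by (intro locally_integrable_square_integrable L2_component)

lemma L2_degree: "u \<in> L2 r \<Longrightarrow> int (card J) \<noteq> r \<Longrightarrow> u x $ J = 0"
  unfolding L2_def by blast

lemma L2I_continuous:
  fixes u :: "('n::finite) form"
  assumes u: "continuous_on UNIV u" and supp: "\<And>x. norm x > R \<Longrightarrow> u x = 0"
    and deg: "\<And>x J. int (card J) \<noteq> r \<Longrightarrow> u x $ J = 0"
  shows "u \<in> L2 r"
proof -
  have m: "u \<in> borel_measurable borel" by (rule borel_measurable_continuous_onI[OF u])
  have "integrable lborel (\<lambda>x. (norm (u x))\<^sup>2)"
    by (rule integrable_continuous_bounded_support[where R = R])
      (use u supp in \<open>auto intro!: continuous_intros\<close>)
  then have "integrable heis_volume (\<lambda>x. (norm (u x))\<^sup>2)"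
    using m by (subst integrable_heis_volume) auto
  then show ?thesis
    using m deg by (auto simp: L2_def cong: measurable_cong_sets)
qed

lemma L2_inner_commute: "L2_inner u v = cnj (L2_inner v u)"
  unfolding L2_inner_def Bochner_Integration.integral_cnj[symmetric]
  by (intro Bochner_Integration.integral_cong) (auto simp: mult.commute)

lemma L2_inner_null:
  assumes "AE x in heis_volume. v x = 0"
  shows "L2_inner u v = 0" "L2_inner v u = 0"
  unfolding L2_inner_def using assms by (auto intro!: integral_eq_zero_AE elim!: AE_mp)

lemma L2_inner_self: "L2_inner u u = of_real (LINT x|heis_volume. (norm (u x))\<^sup>2)"
  unfolding L2_inner_def square_norm_eq_sum Bochner_Integration.integral_complex_of_real[symmetric]
    of_real_sum complex_norm_square ..

lemma L2_inner_self_eq_0: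
  assumes "u \<in> L2 r" "(LINT x|heis_volume. (norm (u x))\<^sup>2) = 0"
  shows "AE x in heis_volume. u x = 0"
  using assms integral_nonneg_eq_0_iff_AE[of heis_volume "\<lambda>x. (norm (u x))\<^sup>2"]
  by (simp add: L2_def)

text \<open>The domain conditions justify both pairings: (b|b) = (s|g) and (f|s) = (a|a). As f + g =
  0, the squared norm of b is minus that of a, and both vanish.\<close>

lemma harmonic_formsE:
  assumes "s \<in> harmonic_forms l q"
  obtains a b where "s \<in> L2 q" "(s, a) \<in> dbar_adj l (q - 1)" "(s, b) \<in> dbar l q"
    "AE x in heis_volume. a x = 0" "AE x in heis_volume. b x = 0"
proof -
  obtain a f b g where *: "(s, a) \<in> dbar_adj l (q - 1)" "(a, f) \<in> dbar l (q - 1)"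
      "(s, b) \<in> dbar l q" "(b, g) \<in> dbar_adj l q" and fg: "(\<lambda>x. 0) = (\<lambda>x. f x + g x)"
    using assms unfolding harmonic_forms_def kohn_laplacian_def by auto
  have aa: "L2_inner f s = L2_inner a a" and bb: "L2_inner b b = L2_inner s g"
    using * unfolding dbar_adj_def by blast+
  have g: "g = (\<lambda>x. - f x)"
    using fun_cong[OF fg] by (auto simp: fun_eq_iff eq_neg_iff_add_eq_0 add.commute)
  have "L2_inner s g = - L2_inner s f"
    by (simp add: L2_inner_def g sum_negf)
  then have "L2_inner b b = - cnj (L2_inner a a)"
    using aa bb L2_inner_commute[of s f] by simp
  then have "(LINT x|heis_volume. (norm (b x))\<^sup>2) = - (LINT x|heis_volume. (norm (a x))\<^sup>2)"
    unfolding L2_inner_self by (metis complex_cnj_complex_of_real of_real_eq_iff of_real_minus)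
  moreover have "(LINT x|heis_volume. (norm (b x))\<^sup>2) \<ge> 0" "(LINT x|heis_volume. (norm (a x))\<^sup>2) \<ge> 0"
    by (rule Bochner_Integration.integral_nonneg, simp)+
  moreover have "s \<in> L2 q" "a \<in> L2 (q - 1)" "b \<in> L2 (q + 1)"
    using * by (auto simp: dbar_def dbar_adj_def)
  ultimately show ?thesis
    using L2_inner_self_eq_0[of a] L2_inner_self_eq_0[of b] * by (intro that[of a b]) auto
qed

section \<open>Pairing with test functions and test forms\<close>

lemma integrable_test_function_mult:
  assumes s: "locally_integrable s" and g: "continuous_on UNIV g" "\<And>x. norm x > R \<Longrightarrow> g x = 0"
  shows "integrable lborel (\<lambda>x. g x * s x)"
proof -
  obtain M where M: "\<And>x. norm x \<le> R \<Longrightarrow> norm (g x) \<le> M"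
    using continuous_on_bounded_cball[OF g(1), where r = R] by blast
  have "norm (g x) \<le> M * indicator (cball 0 R) x" for x
    using M[of x] g(2)[of x] by (auto split: split_indicator)
  then show ?thesis
    by (intro integrable_mult_locally_integrable[OF s borel_measurable_continuous_onI[OF g(1)]])
qed

lemma hfield_outside_ball:
  assumes "\<And>x. norm x > R \<Longrightarrow> f x = 0" and "norm x > R"
  shows "hfield l c j f x = 0"
  using frechet_derivative_outside_ball[OF assms] by (simp add: hfield_def)

lemma integrable_hfield_mult:
  assumes s: "locally_integrable s" and \<phi>: "\<phi> \<in> test_functions"
  shows "integrable lborel (\<lambda>x. hfield l c j \<phi> x * s x)"
proof -
  obtain R where "\<And>x. norm x > R \<Longrightarrow> \<phi> x = 0"
    using test_functions_bounded_support[OF \<phi>] by blast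
  then show ?thesis
    by (intro integrable_test_function_mult[OF s, where R = R] hfield_outside_ball
        Ck_imp_continuous_on[OF Ck_hfield[OF test_functions_Ck[OF \<phi>]]])
qed

lemma test_function_locally_integrable:
  assumes \<phi>: "\<phi> \<in> test_functions"
  shows "locally_integrable \<phi>"
proof -
  obtain R where R: "\<And>x. norm x > R \<Longrightarrow> \<phi> x = 0"
    using test_functions_bounded_support[OF \<phi>] by blast
  note c = Ck_imp_continuous_on[OF test_functions_Ck[OF \<phi>, of 0]]
  have "integrable lborel (\<lambda>x. (norm (\<phi> x))\<^sup>2)"
    by (rule integrable_continuous_bounded_support[where R = R])
      (use c R in \<open>auto intro!: continuous_intros\<close>)
  then show ?thesis
    by (intro locally_integrable_square_integrable borel_measurable_continuous_onI[OF c])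
qed

lemma integral_hfield_by_parts:
  assumes \<phi>: "\<phi> \<in> test_functions" and \<psi>: "\<psi> \<in> test_functions"
  shows "(LINT x|lborel. hfield l c j \<phi> x * \<psi> x) = - (LINT x|lborel. hfield l c j \<psi> x * \<phi> x)"
proof -
  note C = test_functions_Ck[OF \<phi>] test_functions_Ck[OF \<psi>]
  obtain R where R: "\<And>x. norm x > R \<Longrightarrow> \<phi> x = 0"
    using test_functions_bounded_support[OF \<phi>] by blast
  note loc = test_function_locally_integrable
  have "(LINT x|lborel. hfield l c j (\<lambda>x. \<phi> x * \<psi> x) x) = 0"
    using R by (intro integral_hfield_eq_0(2)[where R = R] Ck_mult C) auto
  moreover have "hfield l c j (\<lambda>x. \<phi> x * \<psi> x) x = hfield l c j \<psi> x * \<phi> x + hfield l c j \<phi> x * \<psi> x" for x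
    by (subst hfield_mult[OF Ck_differentiable[OF C(1)] Ck_differentiable[OF C(2)]]) simp
  ultimately have "(LINT x|lborel. hfield l c j \<psi> x * \<phi> x) + (LINT x|lborel. hfield l c j \<phi> x * \<psi> x) = 0"
    using integrable_hfield_mult[OF loc[OF \<phi>] \<psi>] integrable_hfield_mult[OF loc[OF \<psi>] \<phi>]
    by (simp add: Bochner_Integration.integral_add)
  then show ?thesis by (simp add: eq_neg_iff_add_eq_0 add.commute)
qed

lemma dist_of_eq:
  fixes f :: "('n::finite) heis \<Rightarrow> complex"
  assumes "f \<in> borel_measurable borel" "\<phi> \<in> borel_measurable borel"
  shows "dist_of f \<phi> = 2 ^ CARD('n) * (LINT x|lborel. \<phi> x * f x)"
  unfolding dist_of_def using assms
  by (subst integral_heis_volume) (auto simp: scaleR_conv_of_real mult.commute)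

lemma Zbar_dist_of:
  fixes f :: "('n::finite) heis \<Rightarrow> complex"
  assumes f: "locally_integrable f" and \<phi>: "\<phi> \<in> test_functions"
  shows "Zbar l j (dist_of f) \<phi> = - (2 ^ CARD('n) * (LINT x|lborel. hfield l \<i> j \<phi> x * f x))"
proof -
  let ?N = "2 ^ CARD('n) :: complex"
  let ?D = "\<lambda>v x. frechet_derivative \<phi> (at x) v"
  obtain R where R: "\<And>x. norm x > R \<Longrightarrow> \<phi> x = 0"
    using test_functions_bounded_support[OF \<phi>] by blast
  have fm: "f \<in> borel_measurable borel" using f by (simp add: locally_integrable_def)
  have cD: "continuous_on UNIV (?D v)" for v
    by (rule Ck_imp_continuous_on[OF Ck_frechet_derivative[OF test_functions_Ck[OF \<phi>, of "Suc 0"]]])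
  have cA: "continuous_on UNIV (\<lambda>x. field_coeff l \<i> j x * ?D (0, 1) x)"
    by (intro continuous_intros cD Ck_imp_continuous_on[OF Ck_field_coeff])
  have D: "dist_deriv v (dist_of f) \<phi> = - (?N * (LINT x|lborel. ?D v x * f x))" for v
    unfolding dist_deriv_def by (subst dist_of_eq[OF fm borel_measurable_continuous_onI[OF cD]]) simp
  have coeff: "(\<lambda>(z, t). \<i> * of_real (l j) * z $ j) = field_coeff l \<i> j"
    by (auto simp: field_coeff_def fun_eq_iff) (metis complex_eq)
  \<comment> \<open>In the distribution the coefficient multiplies after the derivative is taken, so
    it is transposed to the inside of the derivative of the test function. It does not depend on t
    and can be pulled out again.\<close>
  have "frechet_derivative (\<lambda>x. field_coeff l \<i> j x * \<phi> x) (at x) (0, 1) = field_coeff l \<i> j x * ?D (0, 1) x"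
    for x
    using frechet_derivative_mult[OF Ck_differentiable[OF Ck_field_coeff]
        Ck_differentiable[OF test_functions_Ck[OF \<phi>]], of l \<i> j x "(0, 1)"]
    by (simp add: frechet_derivative_field_coeff) (simp add: field_coeff_def)
  then have T: "dist_mult (\<lambda>(z, t). \<i> * of_real (l j) * z $ j) (dist_deriv (0, 1) (dist_of f)) \<phi> =
      - (?N * (LINT x|lborel. field_coeff l \<i> j x * ?D (0, 1) x * f x))"
    unfolding dist_mult_def dist_deriv_def coeff
    by (simp add: dist_of_eq[OF fm borel_measurable_continuous_onI[OF cA]])
  have out: "?D v x = 0" if "norm x > R" for v x
    using R that by (rule frechet_derivative_outside_ball)
  have int: "integrable lborel (\<lambda>x. ?D v x * f x)"
      "integrable lborel (\<lambda>x. field_coeff l \<i> j x * ?D (0, 1) x * f x)" for v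
    by (rule integrable_test_function_mult[OF f, where R = R],
        use cD cA out in auto)+
  have "(LINT x|lborel. hfield l \<i> j \<phi> x * f x) =
      (LINT x|lborel. (1/2) * (?D (axis j 1, 0) x * f x) + (\<i>/2) * (?D (axis j \<i>, 0) x * f x)
      + field_coeff l \<i> j x * ?D (0, 1) x * f x)"
    unfolding hfield_def
    by (intro Bochner_Integration.integral_cong) (auto simp: algebra_simps add_divide_distrib)
  also have "\<dots> = (1/2) * (LINT x|lborel. ?D (axis j 1, 0) x * f x) + (\<i>/2) * (LINT x|lborel. ?D (axis j \<i>, 0) x * f x)
      + (LINT x|lborel. field_coeff l \<i> j x * ?D (0, 1) x * f x)"
    by (simp only: int Bochner_Integration.integral_add Bochner_Integration.integrable_add
        integrable_mult_right integral_mult_right_zero)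
  finally show ?thesis
    unfolding Zbar_def D T by (simp add: algebra_simps add_divide_distrib diff_divide_distrib)
qed

lemma weak_dbar:
  assumes sb: "(s, b) \<in> dbar l r" and b: "AE x in heis_volume. b x = 0" and \<phi>: "\<phi> \<in> test_functions"
  shows "(\<Sum>J\<in>UNIV. \<Sum>j\<in>UNIV. (LINT x|lborel. hfield l \<i> j \<phi> x * s x $ J) * dzbar_wedge j J $ K) = 0"
    (is "?S = 0")
proof -
  let ?N = "2 ^ CARD('a) :: complex"
  have s: "s \<in> L2 r" and eq: "dbar_dist l s K \<phi> = dist_of (\<lambda>x. b x $ K) \<phi>"
    using sb \<phi> by (auto simp: dbar_def)
  have "dist_of (\<lambda>x. b x $ K) \<phi> = 0"
    unfolding dist_of_def using b by (auto intro!: integral_eq_zero_AE elim!: AE_mp)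
  moreover have "dbar_dist l s K \<phi> = - ?N * ?S"
    unfolding dbar_dist_def Zbar_dist_of[OF L2_component_locally_integrable[OF s] \<phi>]
    by (simp add: sum_distrib_left sum_negf mult.assoc)
  ultimately show ?thesis using eq by simp
qed

text \<open>The Hilbert space adjoint is known only through pairings with the graph of dbar. Forms
  with a single test coefficient lie in this graph with their classical image, and each supplies one
  weak equation for an element of the adjoint's graph.\<close>

lemma dbar_test_form:
  fixes l :: "'n::{finite,linorder} \<Rightarrow> real"
  assumes \<psi>: "\<psi> \<in> test_functions" and r: "int (card K) = r"
  shows "(\<lambda>x. \<chi> J. if J = K then \<psi> x else 0,
    \<lambda>x. \<chi> J. \<Sum>j\<in>UNIV. hfield l \<i> j \<psi> x * dzbar_wedge j K $ J) \<in> dbar l r"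
proof -
  let ?u = "\<lambda>x. \<chi> J. if J = K then \<psi> x else 0"
  let ?f = "\<lambda>x. \<chi> J. \<Sum>j\<in>UNIV. hfield l \<i> j \<psi> x * dzbar_wedge j K $ J"
  obtain R where R: "\<And>x. norm x > R \<Longrightarrow> \<psi> x = 0"
    using test_functions_bounded_support[OF \<psi>] by blast
  note c\<psi> = Ck_imp_continuous_on[OF test_functions_Ck[OF \<psi>, of 0]]
  have ch: "continuous_on UNIV (hfield l \<i> j \<psi>)" for j
    by (rule Ck_imp_continuous_on[OF Ck_hfield[OF test_functions_Ck[OF \<psi>, of "Suc 0"]]])
  have u: "?u \<in> L2 r"
  proof (rule L2I_continuous[where R = R])
    show "continuous_on UNIV ?u"
    proof (rule continuous_on_vec_lambda)
      show "continuous_on UNIV (\<lambda>x. if J = K then \<psi> x else 0)" for J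
        using c\<psi> by (cases "J = K") auto
    qed
  qed (use R r in \<open>auto simp: vec_eq_iff\<close>)
  have f: "?f \<in> L2 (r + 1)"
  proof (rule L2I_continuous[where R = R])
    show "continuous_on UNIV ?f"
      by (intro continuous_on_vec_lambda continuous_intros ch)
    show "?f x = 0" if "norm x > R" for x
      using hfield_outside_ball[OF R that] by (simp add: vec_eq_iff)
    show "?f x $ J = 0" if "int (card J) \<noteq> r + 1" for x J
    proof -
      have "dzbar_wedge j K $ J = 0" for j
        using that r by (auto simp: dzbar_wedge_nth_right)
      then show ?thesis by simp
    qed
  qed
  have "dbar_dist l ?u K' \<theta> = dist_of (\<lambda>x. ?f x $ K') \<theta>" if \<theta>: "\<theta> \<in> test_functions" for K' \<theta>
  proof -
    let ?N = "2 ^ CARD('n) :: complex"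
    have "dbar_dist l ?u K' \<theta> = (\<Sum>J\<in>UNIV. \<Sum>j\<in>UNIV.
        - (?N * (LINT x|lborel. hfield l \<i> j \<theta> x * (if J = K then \<psi> x else 0))) * dzbar_wedge j J $ K')"
      unfolding dbar_dist_def Zbar_dist_of[OF L2_component_locally_integrable[OF u] \<theta>] by simp
    also have "\<dots> = (\<Sum>J\<in>UNIV. if J = K then \<Sum>j\<in>UNIV.
        - (?N * (LINT x|lborel. hfield l \<i> j \<theta> x * \<psi> x)) * dzbar_wedge j K $ K' else 0)"
      by (intro sum.cong) auto
    also have "\<dots> = (\<Sum>j\<in>UNIV. ?N * ((LINT x|lborel. hfield l \<i> j \<psi> x * \<theta> x) * dzbar_wedge j K $ K'))"
      unfolding integral_hfield_by_parts[OF \<psi> \<theta>] by (simp add: algebra_simps)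
    also have "\<dots> = ?N * (LINT x|lborel. (\<Sum>j\<in>UNIV. hfield l \<i> j \<psi> x * \<theta> x * dzbar_wedge j K $ K'))"
      using integrable_hfield_mult[OF test_function_locally_integrable[OF \<theta>] \<psi>]
      by (subst Bochner_Integration.integral_sum) (auto simp: sum_distrib_left)
    also have "\<dots> = dist_of (\<lambda>x. ?f x $ K') \<theta>"
      using Ck_imp_continuous_on[OF test_functions_Ck[OF \<theta>, of 0]] L2_component(1)[OF f]
      by (subst dist_of_eq)
        (auto simp: sum_distrib_left mult_ac intro!: borel_measurable_continuous_onI)
    finally show ?thesis .
  qed
  then show ?thesis using u f by (simp add: dbar_def)
qed

lemma weak_dbar_adj:
  fixes l :: "'n::{finite,linorder} \<Rightarrow> real"
  assumes sa: "(s, a) \<in> dbar_adj l (r - 1)" and a: "AE x in heis_volume. a x = 0"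
    and \<phi>: "\<phi> \<in> test_functions" and K: "int (card K) = r - 1"
  shows "(\<Sum>J\<in>UNIV. \<Sum>j\<in>UNIV. (LINT x|lborel. hfield l (- \<i>) j \<phi> x * s x $ J) * dzbar_wedge j K $ J) = 0"
proof -
  let ?N = "2 ^ CARD('n) :: complex"
  \<comment> \<open>The inner product conjugates its second argument; starting from the conjugate of
    \<phi>, the field Zbar_j on \<psi> becomes Z_j on \<phi>.\<close>
  define \<psi> where "\<psi> = (\<lambda>x. cnj (\<phi> x))"
  obtain R where R: "\<And>x. norm x > R \<Longrightarrow> \<phi> x = 0"
    using test_functions_bounded_support[OF \<phi>] by blast
  have \<psi>: "\<psi> \<in> test_functions"
    unfolding \<psi>_def using R
    by (intro test_functionsI[where R = R] Ck_linear_compose[OF bounded_linear_cnj] test_functions_Ck[OF \<phi>]) auto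
  let ?f = "\<lambda>x. \<chi> J. \<Sum>j\<in>UNIV. hfield l \<i> j \<psi> x * dzbar_wedge j K $ J"
  have s: "s \<in> L2 r" using sa by (simp add: dbar_adj_def)
  have "L2_inner ?f s = 0"
    using sa dbar_test_form[OF \<psi> K, of l] L2_inner_null(1)[OF a] by (fastforce simp: dbar_adj_def)
  then have "0 = cnj (L2_inner ?f s)" by simp
  also have "\<dots> = L2_inner s ?f" by (rule L2_inner_commute[symmetric])
  also have "\<dots> = (LINT x|heis_volume. (\<Sum>J\<in>UNIV. \<Sum>j\<in>UNIV.
      hfield l (- \<i>) j \<phi> x * s x $ J * dzbar_wedge j K $ J))"
    unfolding L2_inner_def
  proof (intro Bochner_Integration.integral_cong sum.cong refl)
    fix x J
    have w: "cnj (dzbar_wedge j K $ J) = dzbar_wedge j K $ J" for j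
      by (simp add: dzbar_wedge_nth_right ins_sign_def)
    have h: "cnj (hfield l \<i> j \<psi> x) = hfield l (- \<i>) j \<phi> x" for j
      by (subst cnj_hfield[OF Ck_differentiable[OF test_functions_Ck[OF \<psi>]]]) (simp add: \<psi>_def)
    show "s x $ J * cnj (?f x $ J) = (\<Sum>j\<in>UNIV. hfield l (- \<i>) j \<phi> x * s x $ J * dzbar_wedge j K $ J)"
      by (simp add: w h sum_distrib_left mult_ac)
  qed
  also have "\<dots> = ?N * (LINT x|lborel. (\<Sum>J\<in>UNIV. \<Sum>j\<in>UNIV.
      hfield l (- \<i>) j \<phi> x * s x $ J * dzbar_wedge j K $ J))"
  proof -
    have "hfield l (- \<i>) j \<phi> \<in> borel_measurable borel" for j
      by (rule borel_measurable_continuous_onI[OF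
            Ck_imp_continuous_on[OF Ck_hfield[OF test_functions_Ck[OF \<phi>, of "Suc 0"]]]])
    then show ?thesis
      using L2_component(1)[OF s]
      by (subst integral_heis_volume) (auto simp: scaleR_conv_of_real intro!: borel_measurable_sum borel_measurable_times)
  qed
  also have "\<dots> = ?N * (\<Sum>J\<in>UNIV. \<Sum>j\<in>UNIV.
      (LINT x|lborel. hfield l (- \<i>) j \<phi> x * s x $ J) * dzbar_wedge j K $ J)"
    using integrable_hfield_mult[OF L2_component_locally_integrable[OF s] \<phi>]
    by (simp add: Bochner_Integration.integral_sum)
  finally show ?thesis by simp
qed

lemma harmonic_form_AE_eq_0:
  fixes l :: "'n::{finite,linorder} \<Rightarrow> real"
  assumes l: "(\<exists>j. l j = 0) \<or> q \<notin> {card {j. l j < 0}, card {j. l j > 0}}"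
    and s: "s \<in> harmonic_forms l (int q)"
  shows "s \<in> L2_null (int q)"
proof -
  obtain a b where s2: "s \<in> L2 (int q)" and sa: "(s, a) \<in> dbar_adj l (int q - 1)"
    and sb: "(s, b) \<in> dbar l (int q)"
    and a: "AE x in heis_volume. a x = 0" and b: "AE x in heis_volume. b x = 0"
    using harmonic_formsE[OF s] by metis
  note loc = L2_component_locally_integrable[OF s2]
  have "AE x in lborel. s x $ L = 0" for L
  proof (cases "card L = q")
    case False
    then show ?thesis using L2_degree[OF s2] by simp
  next
    case True
    show ?thesis
    proof (rule fundamental_lemma[OF loc])
      fix \<phi> :: "'n heis \<Rightarrow> complex"
      assume "\<And>k. Ck k \<phi>" "compact (closure {x. \<phi> x \<noteq> 0})"
      then have \<phi>: "\<phi> \<in> test_functions" by (simp add: test_functions_def)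
      define S where "S = (\<lambda>J. smoothing l \<phi> (\<lambda>x. s x $ J))"
      have S: "Ck (Suc (Suc 0)) (S J)" for J
        unfolding S_def by (rule Ck_smoothing[OF \<phi> loc])
      have hS: "hfield l c j (S J) x = - (LINT y|lborel. hfield l c j (\<lambda>y. \<phi> (hquot l (x, y))) y * s y $ J)"
        if "c * c = - 1" for c j J x
        unfolding S_def by (rule hfield_smoothing[OF \<phi> loc that])
      \<comment> \<open>The weak equation is tested with the translated weight y \<mapsto> \<phi>(y
        x^-1), and \<open>hS\<close> reads the result as an equation for S at x.\<close>
      have "(\<Sum>J\<in>UNIV. \<Sum>j\<in>UNIV. hfield l \<i> j (S J) x * dzbar_wedge j J $ K) = 0" for K x
        using weak_dbar[OF sb b test_function_hquot[OF \<phi>, of l x], of K] by (simp add: hS sum_negf)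
      moreover have "(\<Sum>J\<in>UNIV. \<Sum>j\<in>UNIV. hfield l (- \<i>) j (S J) x * dzbar_wedge j K $ J) = 0" for K x
      proof (cases "int (card K) = int q - 1")
        case True
        then show ?thesis
          using weak_dbar_adj[OF sa a test_function_hquot[OF \<phi>, of l x] True] by (simp add: hS sum_negf)
      next
        case False
        \<comment> \<open>In the remaining degrees no test form is at hand, but the sum is trivial:
          a nonzero wedge coefficient requires card J = card K + 1, hence card J \<noteq> q, and
          such components of S are 0.\<close>
        have "hfield l (- \<i>) j (S J) x * dzbar_wedge j K $ J = 0" for j J
        proof (cases "int (card J) = int q")
          case True
          then have "dzbar_wedge j K $ J = 0"
            using False by (auto simp: dzbar_wedge_nth_right)
          then show ?thesis by simp
        next
          case False
          then have "S J = (\<lambda>_. 0)" using L2_degree[OF s2] by (simp add: S_def)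
          then show ?thesis by simp
        qed
        then show ?thesis by (intro sum.neutral ballI)
      qed
      ultimately have "(\<Sum>j\<in>UNIV. if j \<in> L then hfield l \<i> j (hfield l (- \<i>) j (S L)) x
          else hfield l (- \<i>) j (hfield l \<i> j (S L)) x) = 0" for x
        by (rule kohn_laplacian_diagonal[OF S])
      moreover have "integrable lborel (\<lambda>x. (norm (S L x))\<^sup>2)"
        unfolding S_def by (rule square_integrable_smoothing[OF \<phi> L2_component[OF s2]])
      \<comment> \<open>Evaluation at the group identity, where the average is the integral of
        \<phi> against the component of s.\<close>
      ultimately have "S L 0 = 0"
        using l True by (intro component_eq_0[where L = L and l = l, OF _ S]) auto
      then show "(LINT x|lborel. \<phi> x * s x $ L) = 0"
        by (simp add: S_def smoothing_0)
    qed
  qed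
  then have "AE x in lborel. \<forall>L. s x $ L = 0" by (intro AE_all_countable[THEN iffD2]) auto
  then have "AE x in heis_volume. s x = 0"
    unfolding AE_heis_volume by (auto simp: vec_eq_iff)
  then show ?thesis using s2 by (simp add: L2_null_def)
qed

text \<open>Forms are functions here and not classes, so the zero space is represented by all null
  forms of the given degree. They are harmonic because each operator maps a null representative to
  the zero form.\<close>

lemma L2_null_subset_harmonic_forms:
  fixes l :: "'n::{finite,linorder} \<Rightarrow> real"
  shows "L2_null q \<subseteq> harmonic_forms l q"
proof
  fix s :: "'n form" assume "s \<in> L2_null q"
  then have s: "s \<in> L2 q" and s0: "AE x in heis_volume. s x = 0" by (auto simp: L2_null_def)
  have z: "(\<lambda>_. 0) \<in> L2 r" for r by (simp add: L2_def)
  have z0: "AE x in heis_volume. (\<lambda>_. 0 :: complex ^ 'n set) x = 0" by simp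
  have dist0: "dist_of (\<lambda>x. u x $ J) \<phi> = 0" if "AE x in heis_volume. u x = 0" for u :: "'n form" and J \<phi>
    unfolding dist_of_def using that by (auto intro!: integral_eq_zero_AE elim!: AE_mp)
  have dbar0: "(u, \<lambda>_. 0) \<in> dbar l r" if "u \<in> L2 r" "AE x in heis_volume. u x = 0" for u r
    using that(1) z dist0[OF that(2)] dist0[OF z0]
    by (simp add: dbar_def dbar_dist_def Zbar_def dist_deriv_def dist_mult_def)
  have adj0: "(v, \<lambda>_. 0) \<in> dbar_adj l (r - 1)" if "v \<in> L2 r" "AE x in heis_volume. v x = 0" for v r
    using that z L2_inner_null(1)[OF that(2)] L2_inner_null(1)[OF z0] by (auto simp: dbar_adj_def)
  have "(s, \<lambda>x. 0 + 0) \<in> kohn_laplacian l q"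
    unfolding kohn_laplacian_def
    using adj0[OF s s0] dbar0[OF z z0, of "q - 1"] dbar0[OF s s0] adj0[OF z z0, of "q + 1"] by force
  then show "s \<in> harmonic_forms l q" by (simp add: harmonic_forms_def)
qed


theorem theorem1p1:
  fixes l :: "'n::{finite,linorder} \<Rightarrow> real" and q :: nat
  assumes "q \<le> CARD('n)"
  shows "((\<exists>j. l j = 0) \<longrightarrow> harmonic_forms l (int q) = L2_null (int q)) \<and>
         ((\<forall>j. l j \<noteq> 0) \<longrightarrow> q \<notin> {card {j. l j < 0}, card {j. l j > 0}} \<longrightarrow>
           harmonic_forms l (int q) = L2_null (int q))"
proof -
  have "harmonic_forms l (int q) = L2_null (int q)"
    if "(\<exists>j. l j = 0) \<or> q \<notin> {card {j. l j < 0}, card {j. l j > 0}}"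
    using harmonic_form_AE_eq_0[OF that] L2_null_subset_harmonic_forms by blast
  then show ?thesis by blast
qed

end
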